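(* Let $(X_1,\dots,X_M)$ have density $f\in\mathrm{MMEam}$ of the form $f(x_1,\dots,x_M)=\sum_{\mathbf i\in\mathscr S}p_{\mathbf i}f_{i_1}(x_1)\cdots f_{i_M}(x_M)$, with $M\ge2$, let $S=\sum_{i=1}^MX_i$ and fix $j\in\{1,\dots,M\}$. For $h\in\mathbb N_0$ and $y\ge0$, $$\mathbb E[S^h\mathbf 1\{S>y\}]=\sum_{\mathbf i\in\mathscr S}p_{\mathbf i}\,\alpha_{\mathbf i}\Big(e^{T_{\mathbf i}y}\sum_{\ell=0}^h(-T_{\mathbf i})^{-(h-\ell+1)}\frac{h!}{\ell!}y^\ell\Big)t_{\mathbf i},$$ and for $k\in\mathbb N_+$, $h\in\mathbb N_0$, $y\ge0$, $$\mathbb E[X_j^kS^h\mathbf 1\{S>y\}]=\sum_{\mathbf i\in\mathscr S}p_{\mathbf i}\,k!\,\big(\alpha^{[k]}_{i_j},0\big)\Big\{e^{A^{\{k,\mathbf i,j\}}y}\sum_{\ell=0}^h\big(-A^{\{k,\mathbf i,j\}}\big)^{-(h-\ell+1)}\frac{h!}{\ell!}y^\ell\Big\}\begin{pmatrix}0\\ t_{(\mathbf i,j)}\end{pmatrix},$$ where $$A^{\{k,\mathbf i,j\}}=\begin{pmatrix}T^{[k,0]}_{i_j}& t^{[k]}_{i_j}\alpha_{(\mathbf i,j)}\\ 0&T_{(\mathbf i,j)}\end{pmatrix}.$$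
   Context: An ME density is a probability density on $[0,\infty)$ of the form $g(x)=\alpha e^{Tx}t$ ($\alpha$ real row vector, $T$ real square matrix, $t$ real column vector); triples are taken with all eigenvalues of $T$ having strictly negative real part. MMEam: fix $L,M\in\mathbb N_+$ and ME densities $f_1,\dots,f_L$ with triples $(\alpha_j,T_j,t_j)$. Let $\mathscr S=\{1,\dots,L\}^M$, $\mathbf i=(i_1,\dots,i_M)$, and real numbers $p_{\mathbf i}$ (possibly negative) with $\sum p_{\mathbf i}=1$; $f(x)=\sum_{\mathbf i}p_{\mathbf i}f_{i_1}(x_1)\cdots f_{i_M}(x_M)$ on $[0,\infty)^M$ is an MMEam density if $f\ge0$. Convolution triple: for a finite sequence of indices $(k_1,\dots,k_m)$ in $\{1,\dots,L\}$, define $\alpha=(\alpha_{k_1},0,\dots,0)$, $t=(0,\dots,0,t_{k_m}^\top)^\top$ and $T$ the $m\times m$ block upper bidiagonal matrix with diagonal blocks $T_{k_1},\dots,T_{k_m}$, blocks $t_{k_r}\alpha_{k_{r+1}}$ in position $(r,r+1)$, zeros elsewhere; this triple is the ME representation of the convolution $f_{k_1}*\cdots*f_{k_m}$. $(\alpha_{\mathbf i},T_{\mathbf i},t_{\mathbf i})$ is this triple for the sequence $(i_1,\dots,i_M)$, and $(\alpha_{(\mathbf i,j)},T_{(\mathbf i,j)},t_{(\mathbf i,j)})$ is this triple for the sequence $(i_1,\dots,i_{j-1},i_{j+1},\dots,i_M)$. For a $p\times p$ matrix $T$, $T^{[k,\lambda]}$ is the $(k+1)\times(k+1)$ block matrix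 with $T-\lambda I$ on diagonal blocks, $I$ on blocks immediately above the diagonal, zeros elsewhere; $\alpha^{[k]}_{m}=(\alpha_m,0,\dots,0)$ and $t^{[k]}_m=(0,\dots,0,t_m^\top)^\top$ with $k+1$ blocks. Zero blocks $0$ have the appropriate dimensions. *)

theory Defs
  imports "HOL-Probability.Probability" "Jordan_Normal_Form.Char_Poly"
begin

(* Matrices are Jordan_Normal_Form matrices; row vectors are 1 x p matrices,
   column vectors are p x 1 matrices. *)

definition mat_exp :: "real mat \<Rightarrow> real mat" where
  "mat_exp A = mat (dim_row A) (dim_col A)
      (\<lambda>(r, c). \<Sum>n. (A ^\<^sub>m n) $$ (r, c) / fact n)"

definition mat_inv :: "real mat \<Rightarrow> real mat" where
  "mat_inv A = (SOME B. B \<in> carrier_mat (dim_row A) (dim_row A) \<and>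
       A * B = 1\<^sub>m (dim_row A) \<and> B * A = 1\<^sub>m (dim_row A))"

definition append_cols_mat :: "real mat \<Rightarrow> real mat \<Rightarrow> real mat" where
  "append_cols_mat A B = four_block_mat A B (0\<^sub>m 0 (dim_col A)) (0\<^sub>m 0 (dim_col B))"

type_synonym me_triple = "real mat \<times> real mat \<times> real mat"

definition me_fun :: "me_triple \<Rightarrow> real \<Rightarrow> real" where
  "me_fun tr x = (case tr of (\<alpha>, T, t) \<Rightarrow> (\<alpha> * mat_exp (x \<cdot>\<^sub>m T) * t) $$ (0, 0))"

definition ME_triple :: "me_triple \<Rightarrow> bool" where
  "ME_triple tr = (case tr of (\<alpha>, T, t) \<Rightarrow>
     (\<exists>p>0. \<alpha> \<in> carrier_mat 1 p \<and> T \<in> carrier_mat p p \<and> t \<in> carrier_mat p 1) \<and>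
     (\<forall>z. eigenvalue (map_mat complex_of_real T) z \<longrightarrow> Re z < 0) \<and>
     (\<forall>x\<ge>0. me_fun tr x \<ge> 0) \<and>
     (me_fun tr has_integral 1) {0..})"

(* convolution triple for a sequence (k_1,...,k_m) of indices, given the family
   of triples F; block upper bidiagonal T with T_{k_r} on the diagonal and
   t_{k_r} alpha_{k_{r+1}} immediately above it *)
fun conv_triple :: "(nat \<Rightarrow> me_triple) \<Rightarrow> nat list \<Rightarrow> me_triple" where
  "conv_triple F [] = (0\<^sub>m 1 0, 0\<^sub>m 0 0, 0\<^sub>m 0 1)"
| "conv_triple F [k] = F k"
| "conv_triple F (k # k' # ks) =
     (case F k of (\<alpha>, T, t) \<Rightarrow>
       (case conv_triple F (k' # ks) of (\<alpha>', T', t') \<Rightarrow>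
         (append_cols_mat \<alpha> (0\<^sub>m 1 (dim_col \<alpha>')),
          four_block_mat T (t * \<alpha>') (0\<^sub>m (dim_row T') (dim_col T)) T',
          0\<^sub>m (dim_row T) 1 @\<^sub>r t')))"

(* T^{[k,lambda]} : (k+1) x (k+1) blocks, T - lambda I on the diagonal, I above *)
definition block_T :: "real mat \<Rightarrow> nat \<Rightarrow> real \<Rightarrow> real mat" where
  "block_T T k lam = (let p = dim_row T in
     mat (p * (k + 1)) (p * (k + 1)) (\<lambda>(r, c).
       if r div p = c div p then (T - lam \<cdot>\<^sub>m 1\<^sub>m p) $$ (r mod p, c mod p)
       else if c div p = r div p + 1 then (if r mod p = c mod p then 1 else 0)
       else 0))"

definition block_alpha :: "real mat \<Rightarrow> nat \<Rightarrow> real mat" where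
  "block_alpha \<alpha> k = (let p = dim_col \<alpha> in
     mat 1 (p * (k + 1)) (\<lambda>(r, c). if c < p then \<alpha> $$ (0, c) else 0))"

definition block_t :: "real mat \<Rightarrow> nat \<Rightarrow> real mat" where
  "block_t t k = (let p = dim_row t in
     mat (p * (k + 1)) 1 (\<lambda>(r, c). if p * k \<le> r then t $$ (r - p * k, 0) else 0))"

definition idx_set :: "nat \<Rightarrow> nat \<Rightarrow> nat list set" where
  "idx_set L M = {is. length is = M \<and> set is \<subseteq> {1..L}}"

definition drop_idx :: "nat list \<Rightarrow> nat \<Rightarrow> nat list" where
  "drop_idx is j = take (j - 1) is @ drop j is"

definition mmeam_dens :: "(nat \<Rightarrow> me_triple) \<Rightarrow> nat \<Rightarrow> nat \<Rightarrow> (nat list \<Rightarrow> real)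
    \<Rightarrow> (nat \<Rightarrow> real) \<Rightarrow> real" where
  "mmeam_dens F L M p x =
     (if (\<forall>m\<in>{1..M}. 0 \<le> x m) then
        (\<Sum>is\<in>idx_set L M. p is * (\<Prod>m\<in>{1..M}. me_fun (F (is ! (m - 1))) (x m)))
      else 0)"

definition A_mat :: "(nat \<Rightarrow> me_triple) \<Rightarrow> nat \<Rightarrow> nat list \<Rightarrow> nat \<Rightarrow> real mat" where
  "A_mat F k is j = (case F (is ! (j - 1)) of (\<alpha>, T, t) \<Rightarrow>
     (case conv_triple F (drop_idx is j) of (\<alpha>', T', t') \<Rightarrow>
        four_block_mat (block_T T k 0) (block_t t k * \<alpha>')
           (0\<^sub>m (dim_row T') (dim_row T * (k + 1))) T'))"

definition neg_inv_sum :: "real mat \<Rightarrow> nat \<Rightarrow> real \<Rightarrow> real mat" where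
  "neg_inv_sum A h y = mat (dim_row A) (dim_row A) (\<lambda>(r, c).
     \<Sum>l\<in>{0..h}. fact h / fact l * y ^ l * (mat_inv (- A) ^\<^sub>m (h - l + 1)) $$ (r, c))"

end

theory Submission
  imports Defs "Jordan_Normal_Form.Spectral_Radius"
begin

text \<open>Both expectations reduce, term by term in the mixture, to the tail moment
  \<open>\<integral>\<^sub>y\<^sup>\<infinity> s\<^sup>h g(s) ds\<close> of a single nonnegative matrix-exponential function \<open>g(s) = \<alpha> e\<^bsup>Ts\<^esup> t\<close>, for which
  \<open>s \<mapsto> - \<alpha> e\<^bsup>Ts\<^esup> (\<Sum>\<^sub>l h!/l! s\<^sup>l (-T)\<^bsup>-(h-l+1)\<^esup>) t\<close> is an antiderivative vanishing at infinity. The function \<open>g\<close> arises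
  by convolution: the block bidiagonal triple represents the convolution because
  \<open>u \<mapsto> \<alpha> e\<^bsup>T(v-u)\<^esup> W(u)\<close>, with \<open>W\<close> the upper part of the block exponential applied to \<open>(0, t')\<close>, is an
  antiderivative of \<open>u \<mapsto> \<alpha> e\<^bsup>T(v-u)\<^esup> t \<cdot> \<alpha>' e\<^bsup>T'u\<^esup> t'\<close>. The factor \<open>X\<^sub>j\<^sup>k\<close> is absorbed into the \<open>j\<close>-th
  density, since \<open>k! \<alpha>\<^bsup>[k]\<^esup> e\<^bsup>T\<^bsup>[k,0]\<^esup>x\<^esup> t\<^bsup>[k]\<^esup> = x\<^sup>k \<alpha> e\<^bsup>Tx\<^esup> t\<close>. All component functions
  are nonnegative, so Tonelli applies to each mixture term even though the weights may be negative.\<close>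

section \<open>The matrix exponential\<close>

lemma index_mult_mat_sum:
  assumes "A \<in> carrier_mat nr n" "B \<in> carrier_mat n nc" "i < nr" "j < nc"
  shows "(A * B) $$ (i, j) = (\<Sum>m<n. A $$ (i, m) * B $$ (m, j))"
  using assms by (auto simp: scalar_prod_def atLeast0LessThan intro!: sum.cong)

lemma index_pow_mat_Suc:
  assumes "A \<in> carrier_mat n n" "i < n" "j < n"
  shows "(A ^\<^sub>m Suc k) $$ (i, j) = (\<Sum>m<n. (A ^\<^sub>m k) $$ (i, m) * A $$ (m, j))"
  unfolding pow_mat.simps using assms by (intro index_mult_mat_sum) auto

lemma pow_mat_Suc_left:
  assumes "A \<in> carrier_mat n n"
  shows "A ^\<^sub>m Suc k = A * A ^\<^sub>m k"
  using assms by (induction k) (auto simp: assoc_mult_mat[of _ n n _ n _ n])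

lemma index_pow_mat_Suc_left:
  assumes "A \<in> carrier_mat n n" "i < n" "j < n"
  shows "(A ^\<^sub>m Suc k) $$ (i, j) = (\<Sum>m<n. A $$ (i, m) * (A ^\<^sub>m k) $$ (m, j))"
  unfolding pow_mat_Suc_left[OF assms(1)] using assms by (intro index_mult_mat_sum) auto

lemma smult_pow_mat:
  fixes A :: "'a::comm_ring_1 mat"
  assumes "A \<in> carrier_mat n n"
  shows "(x \<cdot>\<^sub>m A) ^\<^sub>m k = x ^ k \<cdot>\<^sub>m (A ^\<^sub>m k)"
proof (induction k)
  case 0
  then show ?case using assms by (intro eq_matI) auto
next
  case (Suc k)
  have p: "A ^\<^sub>m k \<in> carrier_mat n n" using assms by simp
  have "(x \<cdot>\<^sub>m A) ^\<^sub>m Suc k = (x ^ k \<cdot>\<^sub>m (A ^\<^sub>m k)) * (x \<cdot>\<^sub>m A)"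
    using Suc by simp
  also have "\<dots> = x ^ Suc k \<cdot>\<^sub>m (A ^\<^sub>m Suc k)"
    using assms p by (intro eq_matI) (auto simp: scalar_prod_def sum_distrib_left ac_simps intro!: sum.cong)
  finally show ?case .
qed

text \<open>With \<open>s\<close> the sum of the absolute values of all entries, each multiplication
  by \<open>A\<close> costs at most a factor \<open>real n * s\<close>. This crude rate suffices for
  convergence of the exponential series; decay needs the sharper rate given by the spectral
  radius.\<close>

lemma pow_mat_entry_bound:
  fixes A :: "real mat"
  assumes A: "A \<in> carrier_mat n n"
  obtains c where "c \<ge> 0" "\<And>k i j. i < n \<Longrightarrow> j < n \<Longrightarrow> \<bar>(A ^\<^sub>m k) $$ (i, j)\<bar> \<le> c ^ k"
proof
  define s where "s = (\<Sum>i<n. \<Sum>j<n. \<bar>A $$ (i, j)\<bar>)"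
  show s0: "real n * s \<ge> 0" by (simp add: s_def sum_nonneg)
  have s: "\<bar>A $$ (i, j)\<bar> \<le> s" if "i < n" "j < n" for i j
  proof -
    have "\<bar>A $$ (i, j)\<bar> \<le> (\<Sum>j<n. \<bar>A $$ (i, j)\<bar>)"
      using that by (intro member_le_sum) auto
    also have "\<dots> \<le> s" unfolding s_def
      using that by (intro member_le_sum[of i _ "\<lambda>i. \<Sum>j<n. \<bar>A $$ (i, j)\<bar>"]) (auto intro: sum_nonneg)
    finally show ?thesis .
  qed
  show "\<bar>(A ^\<^sub>m k) $$ (i, j)\<bar> \<le> (real n * s) ^ k" if "i < n" "j < n" for k i j
    using that
  proof (induction k arbitrary: i j)
    case 0
    then show ?case using A by simp
  next
    case (Suc k)
    have "(A ^\<^sub>m Suc k) $$ (i, j) = (\<Sum>m<n. (A ^\<^sub>m k) $$ (i, m) * A $$ (m, j))"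
      by (rule index_pow_mat_Suc[OF A Suc.prems])
    also have "\<bar>\<dots>\<bar> \<le> (\<Sum>m<n. \<bar>(A ^\<^sub>m k) $$ (i, m) * A $$ (m, j)\<bar>)" by (rule sum_abs)
    also have "\<dots> \<le> (\<Sum>m<n. (real n * s) ^ k * s)"
    proof (intro sum_mono)
      fix m assume "m \<in> {..<n}"
      then show "\<bar>(A ^\<^sub>m k) $$ (i, m) * A $$ (m, j)\<bar> \<le> (real n * s) ^ k * s"
        unfolding abs_mult using Suc.prems s0 by (intro mult_mono Suc.IH s zero_le_power) auto
    qed
    also have "\<dots> = (real n * s) ^ Suc k" by simp
    finally show ?case .
  qed
qed

text \<open>Comparison with the series of \<open>exp (c * \<bar>x\<bar>)\<close>. Norms are taken
  because the Cauchy product further down needs absolute convergence.\<close>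

lemma summable_mat_exp_entry:
  fixes A :: "real mat"
  assumes A: "A \<in> carrier_mat n n" and ij: "i < n" "j < n"
  shows "summable (\<lambda>k. norm ((A ^\<^sub>m k) $$ (i, j) / fact k * x ^ k))"
proof -
  obtain c where c: "c \<ge> 0" "\<And>k i j. i < n \<Longrightarrow> j < n \<Longrightarrow> \<bar>(A ^\<^sub>m k) $$ (i, j)\<bar> \<le> c ^ k"
    using pow_mat_entry_bound[OF A] by blast
  show ?thesis
  proof (rule summable_comparison_test')
    show "summable (\<lambda>k. inverse (fact k) * (c * \<bar>x\<bar>) ^ k)" by (rule summable_exp)
    fix k
    have "\<bar>(A ^\<^sub>m k) $$ (i, j)\<bar> * \<bar>x\<bar> ^ k \<le> c ^ k * \<bar>x\<bar> ^ k"
      using c ij by (intro mult_right_mono) auto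
    then show "norm (norm ((A ^\<^sub>m k) $$ (i, j) / fact k * x ^ k)) \<le> inverse (fact k) * (c * \<bar>x\<bar>) ^ k"
      by (simp add: abs_mult power_abs power_mult_distrib divide_simps)
  qed
qed

lemma mat_exp_carrier [simp]: "A \<in> carrier_mat n n \<Longrightarrow> mat_exp A \<in> carrier_mat n n"
  by (simp add: mat_exp_def carrier_matD)

text \<open>Pulling the scalar out of the powers makes every entry a real power series in
  \<open>x\<close>, so differentiation and products reduce to scalar series.\<close>

lemma mat_exp_entry:
  assumes A: "A \<in> carrier_mat n n" and ij: "i < n" "j < n"
  shows "mat_exp (x \<cdot>\<^sub>m A) $$ (i, j) = (\<Sum>k. (A ^\<^sub>m k) $$ (i, j) / fact k * x ^ k)"
  using assms by (simp add: mat_exp_def smult_pow_mat[OF A] mult.commute)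

section \<open>Value at zero and derivatives of the entries\<close>

lemma mat_exp_entry_0:
  assumes A: "A \<in> carrier_mat n n" and ij: "i < n" "j < n"
  shows "mat_exp (0 \<cdot>\<^sub>m A) $$ (i, j) = (if i = j then 1 else 0)"
  using A ij powser_zero[of "\<lambda>k. (A ^\<^sub>m k) $$ (i, j) / fact k"]
  by (simp add: mat_exp_entry[OF A ij])

text \<open>Termwise differentiation: the factor \<open>Suc k\<close> produced by
  \<open>diffs\<close> cancels against \<open>fact (Suc k)\<close>, leaving the next matrix power
  over \<open>fact k\<close>.\<close>

lemma mat_exp_entry_deriv_pow:
  assumes A: "A \<in> carrier_mat n n" and ij: "i < n" "j < n"
  shows "((\<lambda>x. mat_exp (x \<cdot>\<^sub>m A) $$ (i, j)) has_real_derivative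
          (\<Sum>k. (A ^\<^sub>m Suc k) $$ (i, j) / fact k * x ^ k)) (at x)"
proof -
  let ?c = "\<lambda>k. (A ^\<^sub>m k) $$ (i, j) / fact k"
  have "diffs ?c = (\<lambda>k. (A ^\<^sub>m Suc k) $$ (i, j) / fact k)"
    by (auto simp: diffs_def fun_eq_iff divide_simps simp del: pow_mat.simps)
  moreover have "((\<lambda>x. \<Sum>k. ?c k * x ^ k) has_real_derivative (\<Sum>k. diffs ?c k * x ^ k)) (at x)"
    by (rule termdiffs_strong_converges_everywhere summable_norm_cancel[OF summable_mat_exp_entry] assms)+
  ultimately show ?thesis
    by (simp only: mat_exp_entry[OF assms])
qed

text \<open>Splits the additional factor \<open>A\<close> off on the right, which suits a row vector
  times the exponential. The left-handed version that follows suits the exponential times a column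
  vector.\<close>

lemma mat_exp_entry_deriv_right:
  assumes A: "A \<in> carrier_mat n n" and ij: "i < n" "j < n"
  shows "((\<lambda>x. mat_exp (x \<cdot>\<^sub>m A) $$ (i, j)) has_real_derivative
          (\<Sum>m<n. mat_exp (x \<cdot>\<^sub>m A) $$ (i, m) * A $$ (m, j))) (at x)"
proof -
  have "(\<Sum>k. (A ^\<^sub>m Suc k) $$ (i, j) / fact k * x ^ k)
      = (\<Sum>k. \<Sum>m<n. (A ^\<^sub>m k) $$ (i, m) / fact k * x ^ k * A $$ (m, j))"
    using A ij by (intro suminf_cong)
      (simp add: index_pow_mat_Suc[of A n] del: pow_mat.simps add: sum_divide_distrib sum_distrib_right sum_distrib_left ac_simps)
  also have "\<dots> = (\<Sum>m<n. \<Sum>k. (A ^\<^sub>m k) $$ (i, m) / fact k * x ^ k * A $$ (m, j))"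
    using A ij by (intro suminf_sum summable_mult2 summable_norm_cancel[OF summable_mat_exp_entry]) auto
  also have "\<dots> = (\<Sum>m<n. mat_exp (x \<cdot>\<^sub>m A) $$ (i, m) * A $$ (m, j))"
    using A ij by (intro sum.cong refl, subst suminf_mult2[symmetric])
      (auto simp: mat_exp_entry[OF A] simp del: times_divide_eq_left intro: summable_norm_cancel[OF summable_mat_exp_entry])
  finally show ?thesis using mat_exp_entry_deriv_pow[OF assms, of x] by simp
qed

lemma mat_exp_entry_deriv_left:
  assumes A: "A \<in> carrier_mat n n" and ij: "i < n" "j < n"
  shows "((\<lambda>x. mat_exp (x \<cdot>\<^sub>m A) $$ (i, j)) has_real_derivative
          (\<Sum>m<n. A $$ (i, m) * mat_exp (x \<cdot>\<^sub>m A) $$ (m, j))) (at x)"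
proof -
  have "(\<Sum>k. (A ^\<^sub>m Suc k) $$ (i, j) / fact k * x ^ k)
      = (\<Sum>k. \<Sum>m<n. A $$ (i, m) * ((A ^\<^sub>m k) $$ (m, j) / fact k * x ^ k))"
    using A ij by (intro suminf_cong)
      (simp add: index_pow_mat_Suc_left[of A n] del: pow_mat.simps add: sum_divide_distrib sum_distrib_right sum_distrib_left ac_simps)
  also have "\<dots> = (\<Sum>m<n. \<Sum>k. A $$ (i, m) * ((A ^\<^sub>m k) $$ (m, j) / fact k * x ^ k))"
    using A ij by (intro suminf_sum summable_mult summable_norm_cancel[OF summable_mat_exp_entry]) auto
  also have "\<dots> = (\<Sum>m<n. A $$ (i, m) * mat_exp (x \<cdot>\<^sub>m A) $$ (m, j))"
    using A ij by (intro sum.cong refl, subst suminf_mult)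
      (auto simp: mat_exp_entry[OF A] simp del: times_divide_eq_left intro: summable_norm_cancel[OF summable_mat_exp_entry])
  finally show ?thesis using mat_exp_entry_deriv_pow[OF assms, of x] by simp
qed

text \<open>The binomial theorem, valid because a scalar matrix commutes with \<open>A\<close>. The
  induction step multiplies by \<open>A\<close> and by the scalar part separately and recombines the
  results by Pascal's rule.\<close>

lemma pow_mat_add_smult_one:
  fixes A :: "real mat" and c :: real
  assumes A: "A \<in> carrier_mat n n" and ij: "i < n" "j < n"
  shows "((A + c \<cdot>\<^sub>m 1\<^sub>m n) ^\<^sub>m k) $$ (i, j) = (\<Sum>l\<le>k. (k choose l) * c ^ (k - l) * (A ^\<^sub>m l) $$ (i, j))"
  using ij
proof (induction k arbitrary: i j)
  case 0
  then show ?case using A by simp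
next
  case (Suc k)
  let ?B = "A + c \<cdot>\<^sub>m 1\<^sub>m n"
  let ?a = "\<lambda>l. (A ^\<^sub>m l) $$ (i, j)"
  have B: "?B \<in> carrier_mat n n" using A by simp
  have "(?B ^\<^sub>m Suc k) $$ (i, j) = (\<Sum>m<n. (?B ^\<^sub>m k) $$ (i, m) * ?B $$ (m, j))"
    by (rule index_pow_mat_Suc[OF B Suc.prems])
  also have "\<dots> = (\<Sum>m<n. (?B ^\<^sub>m k) $$ (i, m) * A $$ (m, j) + (if m = j then c * (?B ^\<^sub>m k) $$ (i, m) else 0))"
    using A Suc.prems by (intro sum.cong) (auto simp: algebra_simps)
  also have "\<dots> = (\<Sum>m<n. (?B ^\<^sub>m k) $$ (i, m) * A $$ (m, j)) + c * (?B ^\<^sub>m k) $$ (i, j)"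
    using Suc.prems by (simp add: sum.distrib)
  finally have 1: "(?B ^\<^sub>m Suc k) $$ (i, j)
      = (\<Sum>m<n. (?B ^\<^sub>m k) $$ (i, m) * A $$ (m, j)) + c * (?B ^\<^sub>m k) $$ (i, j)" .
  have "(\<Sum>m<n. (?B ^\<^sub>m k) $$ (i, m) * A $$ (m, j))
      = (\<Sum>m<n. \<Sum>l\<le>k. real (k choose l) * c ^ (k - l) * ((A ^\<^sub>m l) $$ (i, m) * A $$ (m, j)))"
    using Suc.prems by (intro sum.cong) (simp_all add: Suc.IH sum_distrib_right mult.assoc)
  also have "\<dots> = (\<Sum>l\<le>k. \<Sum>m<n. real (k choose l) * c ^ (k - l) * ((A ^\<^sub>m l) $$ (i, m) * A $$ (m, j)))"
    by (rule sum.swap)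
  also have "\<dots> = (\<Sum>l\<le>k. real (k choose l) * c ^ (k - l) * ?a (Suc l))"
    unfolding index_pow_mat_Suc[OF A Suc.prems] sum_distrib_left ..
  finally have 2: "(\<Sum>m<n. (?B ^\<^sub>m k) $$ (i, m) * A $$ (m, j)) = \<dots>" .
  have "c * (?B ^\<^sub>m k) $$ (i, j) = (\<Sum>l\<le>k. real (k choose l) * c ^ (Suc k - l) * ?a l)"
    unfolding Suc.IH[OF Suc.prems] by (auto simp: sum_distrib_left Suc_diff_le intro!: sum.cong)
  \<comment> \<open>The added term is 0 because \<open>k choose Suc k\<close> is 0. With it,
    splitting off index 0 gives sums of equal range to which Pascal's rule applies termwise.\<close>
  also have "\<dots> = (\<Sum>l\<le>Suc k. real (k choose l) * c ^ (Suc k - l) * ?a l)" by simp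
  also have "\<dots> = c ^ Suc k * ?a 0 + (\<Sum>l\<le>k. real (k choose Suc l) * c ^ (k - l) * ?a (Suc l))"
    by (subst sum.atMost_Suc_shift) (simp del: pow_mat.simps)
  finally have 3: "c * (?B ^\<^sub>m k) $$ (i, j) = \<dots>" .
  have "(\<Sum>l\<le>Suc k. real (Suc k choose l) * c ^ (Suc k - l) * ?a l)
      = c ^ Suc k * ?a 0 + (\<Sum>l\<le>k. real (Suc k choose Suc l) * c ^ (k - l) * ?a (Suc l))"
    by (subst sum.atMost_Suc_shift) (simp del: pow_mat.simps)
  also have "\<dots> = (\<Sum>l\<le>k. real (k choose l) * c ^ (k - l) * ?a (Suc l))
      + (c ^ Suc k * ?a 0 + (\<Sum>l\<le>k. real (k choose Suc l) * c ^ (k - l) * ?a (Suc l)))"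
    by (simp add: sum.distrib distrib_right del: pow_mat.simps)
  finally show ?case using 1 2 3 by simp
qed

text \<open>The binomial expansion of the powers is exactly the coefficient sequence of the Cauchy
  product of the entry's series with that of \<open>exp (c * x)\<close>.\<close>

lemma mat_exp_add_smult_one:
  assumes A: "A \<in> carrier_mat n n" and ij: "i < n" "j < n"
  shows "mat_exp (x \<cdot>\<^sub>m (A + c \<cdot>\<^sub>m 1\<^sub>m n)) $$ (i, j) = exp (c * x) * mat_exp (x \<cdot>\<^sub>m A) $$ (i, j)"
proof -
  let ?a = "\<lambda>l. (A ^\<^sub>m l) $$ (i, j) / fact l * x ^ l"
  let ?b = "\<lambda>l. inverse (fact l) * (c * x) ^ l"
  have B: "A + c \<cdot>\<^sub>m 1\<^sub>m n \<in> carrier_mat n n" using A by simp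
  have nb: "summable (\<lambda>l. norm (?b l))"
    using summable_norm_exp[of "c * x"] by simp
  have "(\<lambda>k. \<Sum>l\<le>k. ?a l * ?b (k - l)) sums ((\<Sum>k. ?a k) * (\<Sum>k. ?b k))"
    by (intro Cauchy_product_sums summable_mat_exp_entry[OF assms] nb)
  also have "(\<lambda>k. \<Sum>l\<le>k. ?a l * ?b (k - l)) = (\<lambda>k. ((A + c \<cdot>\<^sub>m 1\<^sub>m n) ^\<^sub>m k) $$ (i, j) / fact k * x ^ k)"
  proof
    fix k
    have "?a l * ?b (k - l) = real (k choose l) * c ^ (k - l) * (A ^\<^sub>m l) $$ (i, j) / fact k * x ^ k"
      if "l \<le> k" for l
    proof -
      have "x ^ k = x ^ l * x ^ (k - l)" using that by (simp flip: power_add)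
      then show ?thesis
        using that by (simp add: binomial_fact field_simps power_mult_distrib)
    qed
    then have "(\<Sum>l\<le>k. ?a l * ?b (k - l))
        = (\<Sum>l\<le>k. real (k choose l) * c ^ (k - l) * (A ^\<^sub>m l) $$ (i, j) / fact k * x ^ k)"
      by (intro sum.cong) auto
    then show "(\<Sum>l\<le>k. ?a l * ?b (k - l)) = ((A + c \<cdot>\<^sub>m 1\<^sub>m n) ^\<^sub>m k) $$ (i, j) / fact k * x ^ k"
      by (simp only: pow_mat_add_smult_one[OF assms] sum_divide_distrib sum_distrib_right)
  qed
  also have "(\<Sum>k. ?b k) = exp (c * x)" by (simp add: exp_def divide_inverse mult.commute)
  finally show ?thesis
    by (simp add: mat_exp_entry[OF B ij] mat_exp_entry[OF A ij] sums_iff)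
qed

section \<open>Stability\<close>

definition hurwitz :: "real mat \<Rightarrow> bool" where
  "hurwitz A \<longleftrightarrow> (\<forall>z. eigenvalue (map_mat complex_of_real A) z \<longrightarrow> Re z < 0)"

text \<open>The characteristic matrix is again block triangular, so its determinant is the product
  of those of the two diagonal blocks.\<close>

lemma hurwitz_four_block:
  assumes A: "A \<in> carrier_mat n n" and B: "B \<in> carrier_mat n m" and D: "D \<in> carrier_mat m m"
    and hA: "hurwitz A" and hD: "hurwitz D"
  shows "hurwitz (four_block_mat A B (0\<^sub>m m n) D)"
  unfolding hurwitz_def
proof (intro allI impI)
  let ?c = "map_mat complex_of_real"
  let ?F = "four_block_mat A B (0\<^sub>m m n) D"
  fix z assume ev: "eigenvalue (?c ?F) z"
  have F: "?c ?F \<in> carrier_mat (n + m) (n + m)" using A D by simp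
  have "char_matrix (?c ?F) z = four_block_mat (char_matrix (?c A) z) (?c B) (0\<^sub>m m n) (char_matrix (?c D) z)"
    using A B D by (intro eq_matI) (auto simp: char_matrix_def)
  then have "det (char_matrix (?c A) z) * det (char_matrix (?c D) z) = 0"
    using ev[unfolded eigenvalue_det[OF F]] A B D
    by (simp add: det_four_block_mat_lower_left_zero[of _ n _ m])
  then have "eigenvalue (?c A) z \<or> eigenvalue (?c D) z"
    using A D eigenvalue_det[of "?c A" n] eigenvalue_det[of "?c D" m] by auto
  then show "Re z < 0" using hA hD unfolding hurwitz_def by blast
qed

text \<open>0 is not an eigenvalue, so \<open>- A\<close> has nonzero determinant and the choice in
  \<open>mat_inv\<close> picks a genuine inverse.\<close>

lemma hurwitz_mat_inv:
  assumes A: "A \<in> carrier_mat n n" and h: "hurwitz A"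
  shows "mat_inv (- A) \<in> carrier_mat n n" "- A * mat_inv (- A) = 1\<^sub>m n"
proof -
  let ?c = "map_mat complex_of_real"
  have "\<not> eigenvalue (?c A) 0" using h unfolding hurwitz_def by force
  moreover have "char_matrix (?c A) 0 = ?c A"
    using A by (intro eq_matI) (auto simp: char_matrix_def)
  ultimately have "det (?c A) \<noteq> 0"
    using eigenvalue_det[of "?c A" n 0] A by simp
  then have "det A \<noteq> 0" by simp
  moreover have "- A = - 1 \<cdot>\<^sub>m A" by (intro eq_matI) auto
  ultimately have "det (- A) \<noteq> 0" by simp
  then obtain B where "B \<in> carrier_mat n n" "- A * B = 1\<^sub>m n" "B * - A = 1\<^sub>m n"
    using det_non_zero_imp_unit[of "- A" n] A
    unfolding Units_def ring_mat_def by auto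
  then have "\<exists>B. B \<in> carrier_mat (dim_row (- A)) (dim_row (- A)) \<and>
       - A * B = 1\<^sub>m (dim_row (- A)) \<and> B * - A = 1\<^sub>m (dim_row (- A))"
    using A by auto
  from someI_ex[OF this] show "mat_inv (- A) \<in> carrier_mat n n" "- A * mat_inv (- A) = 1\<^sub>m n"
    unfolding mat_inv_def using A by auto
qed

text \<open>Geometric growth of the powers becomes exponential growth at rate \<open>r\<close>, by
  termwise comparison with the series of \<open>exp (r * x)\<close>.\<close>

lemma mat_exp_entry_abs_le:
  assumes B: "B \<in> carrier_mat n n" and ij: "i < n" "j < n" and x: "x \<ge> 0"
    and bd: "\<And>k. \<bar>(B ^\<^sub>m k) $$ (i, j)\<bar> \<le> K * r ^ k"
  shows "\<bar>mat_exp (x \<cdot>\<^sub>m B) $$ (i, j)\<bar> \<le> K * exp (r * x)"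
proof -
  let ?a = "\<lambda>k. (B ^\<^sub>m k) $$ (i, j) / fact k * x ^ k"
  have e: "(\<lambda>k. K * (inverse (fact k) * (r * x) ^ k)) sums (K * exp (r * x))"
    using exp_converges[of "r * x"] by (intro sums_mult) (simp add: divide_inverse mult.commute)
  have "\<bar>suminf ?a\<bar> \<le> (\<Sum>k. \<bar>?a k\<bar>)"
    using summable_rabs[of ?a] summable_mat_exp_entry[OF B ij, of x] by simp
  also have "\<dots> \<le> (\<Sum>k. K * (inverse (fact k) * (r * x) ^ k))"
  proof (rule suminf_le)
    fix k
    have "\<bar>(B ^\<^sub>m k) $$ (i, j)\<bar> * (x ^ k / fact k) \<le> K * r ^ k * (x ^ k / fact k)"
      using bd x by (intro mult_right_mono) auto
    then show "\<bar>?a k\<bar> \<le> K * (inverse (fact k) * (r * x) ^ k)"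
      using x by (simp add: abs_mult power_mult_distrib field_simps)
  next
    show "summable (\<lambda>k. \<bar>?a k\<bar>)" using summable_mat_exp_entry[OF B ij, of x] by simp
    show "summable (\<lambda>k. K * (inverse (fact k) * (r * x) ^ k))" using e by (simp add: sums_iff)
  qed
  also have "\<dots> = K * exp (r * x)" using e by (simp add: sums_iff)
  finally show ?thesis by (simp add: mat_exp_entry[OF B ij])
qed

text \<open>Since |z + c|^2 = |z|^2 + 2 c Re z + c^2, this is below c^2 once c exceeds |z|^2 / (-2
  Re z), the quantity \<open>q z\<close> below. The spectrum is finite, so one \<open>c\<close>
  serves all eigenvalues.\<close>

lemma hurwitz_shift_radius:
  assumes A: "A \<in> carrier_mat n n" and h: "hurwitz A"
  obtains c r where "0 < r" "r < c"
    "\<And>z. eigenvalue (map_mat complex_of_real A) z \<Longrightarrow> norm (z + complex_of_real c) < r"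
proof -
  define S where "S = spectrum (map_mat complex_of_real A)"
  have fin: "finite S" unfolding S_def using A by (intro card_finite_spectrum(1)[of _ n]) simp
  have neg: "Re z < 0" if "z \<in> S" for z using that h by (simp add: S_def spectrum_def hurwitz_def)
  define q where "q z = (norm z)\<^sup>2 / (2 * - Re z)" for z
  \<comment> \<open>A sum of nonnegative thresholds dominates each of them and makes sense for an
    empty spectrum; the added 1 makes the inequality strict.\<close>
  define c where "c = 1 + (\<Sum>z\<in>S. q z)"
  have q0: "q z \<ge> 0" if "z \<in> S" for z using neg[OF that] by (simp add: q_def divide_nonneg_neg)
  then have c1: "c \<ge> 1" unfolding c_def by (simp add: sum_nonneg)
  have lt: "norm (z + of_real c) < c" if z: "z \<in> S" for z
  proof -
    have "q z \<le> (\<Sum>z\<in>S. q z)" using z fin q0 by (intro member_le_sum) auto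
    then have "q z < c" by (simp add: c_def)
    then have "(norm z)\<^sup>2 < c * (2 * - Re z)"
      using neg[OF z] by (simp add: q_def field_simps)
    moreover have "(norm (z + of_real c))\<^sup>2 = (norm z)\<^sup>2 - c * (2 * - Re z) + c\<^sup>2"
      unfolding cmod_power2 by (simp add: power2_sum)
    ultimately have "(norm (z + of_real c))\<^sup>2 < c\<^sup>2" by linarith
    then show ?thesis using c1 by (auto intro: power2_less_imp_less)
  qed
  \<comment> \<open>The inserted 0 keeps the maximum defined when there are no eigenvalues and gives
    \<open>0 \<le> m\<close>. The radius is then the midpoint of \<open>m\<close> and
    \<open>c\<close>, which is positive and strictly between them.\<close>
  define m where "m = Max (insert 0 ((\<lambda>z. norm (z + of_real c)) ` S))"
  have m: "0 \<le> m" "\<And>z. z \<in> S \<Longrightarrow> norm (z + of_real c) \<le> m" "m < c"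
    unfolding m_def using fin lt c1 by auto
  show ?thesis
  proof
    show "0 < (m + c) / 2" "(m + c) / 2 < c" using m c1 by auto
    fix z assume "eigenvalue (map_mat complex_of_real A) z"
    then have "z \<in> S" by (simp add: S_def spectrum_def)
    then show "norm (z + of_real c) < (m + c) / 2" using m(2)[of z] m(3) by simp
  qed
qed

text \<open>For large \<open>c\<close> the disc of radius \<open>c\<close> around \<open>-c\<close> contains the spectrum of \<open>A\<close>, so \<open>A + cI\<close> has
  spectral radius below some \<open>r < c\<close> and its powers grow at most like \<open>r\<^sup>k\<close>; then \<open>e\<^bsup>xA\<^esup> = e\<^bsup>-cx\<^esup> e\<^bsup>x(A + cI)\<^esup>\<close> decays.\<close>

lemma hurwitz_mat_exp_decay:
  assumes A: "A \<in> carrier_mat n n" and h: "hurwitz A"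
  shows "\<exists>K. \<exists>d>0. \<forall>x\<ge>0. \<forall>i<n. \<forall>j<n. \<bar>mat_exp (x \<cdot>\<^sub>m A) $$ (i, j)\<bar> \<le> K * exp (- d * x)"
\<comment> \<open>In dimension 0 the bound is vacuous; the spectral radius, a maximum over the
  spectrum, needs a nonempty spectrum.\<close>
proof (cases "n = 0")
  case True
  then show ?thesis by (auto intro: exI[of _ 1])
next
  case False
  let ?c = "map_mat complex_of_real"
  obtain c r where r: "0 < r" "r < c"
    and ev: "\<And>z. eigenvalue (?c A) z \<Longrightarrow> norm (z + complex_of_real c) < r"
    using hurwitz_shift_radius[OF A h] by blast
  define B where "B = A + c \<cdot>\<^sub>m 1\<^sub>m n"
  define C where "C = inverse r \<cdot>\<^sub>m B"
  have B: "B \<in> carrier_mat n n" and C: "C \<in> carrier_mat n n" using A by (auto simp: B_def C_def)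
  have cC: "?c C \<in> carrier_mat n n" using C by simp
  have "norm w < 1" if w: "eigenvalue (?c C) w" for w
  proof -
    \<comment> \<open>Eigenvalues of \<open>C\<close> are those of \<open>A\<close> shifted by
      \<open>c\<close> and divided by \<open>r\<close>, hence of modulus below 1.\<close>
    have "char_matrix (?c A) (r * w - c) = complex_of_real r \<cdot>\<^sub>m char_matrix (?c C) w"
      using A r by (intro eq_matI) (auto simp: char_matrix_def C_def B_def algebra_simps)
    then have "eigenvalue (?c A) (r * w - c)"
      using w A C by (simp add: eigenvalue_det[of _ n])
    from ev[OF this] show ?thesis using r by (simp add: norm_mult)
  qed
  then have "spectral_radius (?c C) < 1"
    using spectral_radius_mem_max(1)[OF cC] False by (auto simp: spectrum_def)
  \<comment> \<open>A spectral radius strictly below 1 bounds all powers by one constant, because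
    the polynomial factors from Jordan blocks are absorbed by the geometric decay. This is why
    \<open>B\<close> was divided by \<open>r\<close> first.\<close>
  then obtain K where K: "\<And>k. norm_bound (?c C ^\<^sub>m k) K"
    using spectral_radius_jnf_norm_bound_less_1_upper_triangular[OF cC] by blast
  have Ck: "\<bar>(C ^\<^sub>m k) $$ (i, j)\<bar> \<le> K" if "i < n" "j < n" for i j k
  proof -
    have "?c C ^\<^sub>m k = ?c (C ^\<^sub>m k)" using of_real_hom.mat_hom_pow[OF C] by metis
    then show ?thesis using K[of k] C that unfolding norm_bound_def by auto
  qed
  have "B = r \<cdot>\<^sub>m C" using r B by (intro eq_matI) (auto simp: C_def)
  then have Bk: "\<bar>(B ^\<^sub>m k) $$ (i, j)\<bar> \<le> K * r ^ k" if "i < n" "j < n" for i j k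
    using Ck[OF that, of k] r C that by (simp add: smult_pow_mat[OF C] abs_mult mult.commute)
  show ?thesis
  proof (rule exI[of _ K], rule exI[of _ "c - r"], intro conjI allI impI)
    show "c - r > 0" using r by simp
    fix x :: real and i j assume x: "x \<ge> 0" and ij: "i < n" "j < n"
    have "\<bar>mat_exp (x \<cdot>\<^sub>m B) $$ (i, j)\<bar> \<le> K * exp (r * x)"
      using B ij x Bk by (intro mat_exp_entry_abs_le) auto
    then have "exp (c * x) * \<bar>mat_exp (x \<cdot>\<^sub>m A) $$ (i, j)\<bar> \<le> K * exp (r * x)"
      using mat_exp_add_smult_one[OF A ij] by (simp add: B_def abs_mult)
    then have "\<bar>mat_exp (x \<cdot>\<^sub>m A) $$ (i, j)\<bar> \<le> K * exp (r * x) / exp (c * x)"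
      by (simp add: pos_le_divide_eq mult.commute)
    moreover have "exp (- (c - r) * x) = exp (r * x) / exp (c * x)"
      by (simp add: exp_diff[symmetric] algebra_simps)
    ultimately show "\<bar>mat_exp (x \<cdot>\<^sub>m A) $$ (i, j)\<bar> \<le> K * exp (- (c - r) * x)"
      by simp
  qed
qed

section \<open>Tail moments\<close>

lemma me_fun_eq_sum:
  assumes "\<alpha> \<in> carrier_mat 1 n" "T \<in> carrier_mat n n" "t \<in> carrier_mat n 1"
  shows "me_fun (\<alpha>, T, t) x
    = (\<Sum>j<n. \<Sum>i<n. \<alpha> $$ (0, i) * mat_exp (x \<cdot>\<^sub>m T) $$ (i, j) * t $$ (j, 0))"
proof -
  have E: "mat_exp (x \<cdot>\<^sub>m T) \<in> carrier_mat n n" using assms by simp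
  have aE: "\<alpha> * mat_exp (x \<cdot>\<^sub>m T) \<in> carrier_mat 1 n" using E assms by simp
  have "me_fun (\<alpha>, T, t) x = (\<Sum>j<n. (\<alpha> * mat_exp (x \<cdot>\<^sub>m T)) $$ (0, j) * t $$ (j, 0))"
    unfolding me_fun_def prod.case by (rule index_mult_mat_sum[OF aE assms(3)]) auto
  also have "\<dots> = (\<Sum>j<n. (\<Sum>i<n. \<alpha> $$ (0, i) * mat_exp (x \<cdot>\<^sub>m T) $$ (i, j)) * t $$ (j, 0))"
    by (intro sum.cong refl, subst index_mult_mat_sum[OF assms(1) E]) auto
  finally show ?thesis by (simp add: sum_distrib_right)
qed

text \<open>Differentiation only replaces the column \<open>t\<close> by \<open>T * t\<close>.
  Conversely, replacing \<open>t\<close> by its image under the inverse of \<open>T\<close>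
  integrates, which is how the antiderivatives below are built.\<close>

lemma me_fun_deriv:
  assumes a: "\<alpha> \<in> carrier_mat 1 n" and T: "T \<in> carrier_mat n n" and t: "t \<in> carrier_mat n 1"
  shows "(me_fun (\<alpha>, T, t) has_real_derivative me_fun (\<alpha>, T, T * t) x) (at x)"
proof -
  let ?E = "\<lambda>i j x. mat_exp (x \<cdot>\<^sub>m T) $$ (i, j)"
  have "((\<lambda>x. \<Sum>j<n. \<Sum>i<n. \<alpha> $$ (0, i) * ?E i j x * t $$ (j, 0)) has_real_derivative
      (\<Sum>j<n. \<Sum>i<n. \<alpha> $$ (0, i) * (\<Sum>m<n. ?E i m x * T $$ (m, j)) * t $$ (j, 0))) (at x)"
    by (intro DERIV_sum DERIV_cmult_right DERIV_cmult mat_exp_entry_deriv_right[OF T]) auto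
  also have "(\<lambda>x. \<Sum>j<n. \<Sum>i<n. \<alpha> $$ (0, i) * ?E i j x * t $$ (j, 0)) = me_fun (\<alpha>, T, t)"
    by (rule ext) (simp add: me_fun_eq_sum[OF assms])
  also have "(\<Sum>j<n. \<Sum>i<n. \<alpha> $$ (0, i) * (\<Sum>m<n. ?E i m x * T $$ (m, j)) * t $$ (j, 0))
      = (\<Sum>j<n. \<Sum>i<n. \<Sum>m<n. \<alpha> $$ (0, i) * ?E i m x * (T $$ (m, j) * t $$ (j, 0)))"
    by (simp add: sum_distrib_left sum_distrib_right mult.assoc)
  also have "\<dots> = (\<Sum>j<n. \<Sum>m<n. \<Sum>i<n. \<alpha> $$ (0, i) * ?E i m x * (T $$ (m, j) * t $$ (j, 0)))"
    by (intro sum.cong refl sum.swap)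
  also have "\<dots> = (\<Sum>m<n. \<Sum>j<n. \<Sum>i<n. \<alpha> $$ (0, i) * ?E i m x * (T $$ (m, j) * t $$ (j, 0)))"
    by (rule sum.swap)
  also have "\<dots> = (\<Sum>m<n. \<Sum>i<n. \<alpha> $$ (0, i) * ?E i m x * (\<Sum>j<n. T $$ (m, j) * t $$ (j, 0)))"
    by (rule sum.cong[OF refl], subst sum.swap) (simp add: sum_distrib_left)
  also have "\<dots> = (\<Sum>m<n. \<Sum>i<n. \<alpha> $$ (0, i) * ?E i m x * (T * t) $$ (m, 0))"
    using index_mult_mat_sum[OF T t] by simp
  also have "\<dots> = me_fun (\<alpha>, T, T * t) x"
    using T t by (simp add: me_fun_eq_sum[OF a T])
  finally show ?thesis .
qed

lemma me_fun_uminus: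
  assumes "\<alpha> \<in> carrier_mat 1 n" "T \<in> carrier_mat n n" "t \<in> carrier_mat n 1"
  shows "me_fun (\<alpha>, T, - t) x = - me_fun (\<alpha>, T, t) x"
  using assms by (simp add: me_fun_eq_sum[of _ n] sum_negf)

lemma continuous_on_me_fun:
  assumes "\<alpha> \<in> carrier_mat 1 n" "T \<in> carrier_mat n n" "t \<in> carrier_mat n 1"
  shows "continuous_on S (me_fun (\<alpha>, T, t))"
  using DERIV_isCont[OF me_fun_deriv[OF assms]] by (simp add: continuous_at_imp_continuous_on)

lemma borel_measurable_me_fun:
  assumes "\<alpha> \<in> carrier_mat 1 n" "T \<in> carrier_mat n n" "t \<in> carrier_mat n 1"
  shows "me_fun (\<alpha>, T, t) \<in> borel_measurable borel"
  by (rule borel_measurable_continuous_onI[OF continuous_on_me_fun[OF assms]])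

lemma tendsto_power_times_exp_neg:
  fixes d :: real
  assumes "d > 0"
  shows "((\<lambda>s. s ^ k * exp (- d * s)) \<longlongrightarrow> 0) at_top"
proof -
  have "filterlim (\<lambda>s. d * s) at_top at_top"
    by (rule filterlim_tendsto_pos_mult_at_top[OF tendsto_const assms filterlim_ident])
  from filterlim_compose[OF tendsto_power_div_exp_0[of k] this]
  have "((\<lambda>s. (d * s) ^ k / exp (d * s) * inverse (d ^ k)) \<longlongrightarrow> 0 * inverse (d ^ k)) at_top"
    by (rule tendsto_mult[OF _ tendsto_const])
  also have "(\<lambda>s. (d * s) ^ k / exp (d * s) * inverse (d ^ k)) = (\<lambda>s. s ^ k * exp (- d * s))"
  proof
    fix s
    have "(d * s) ^ k / exp (d * s) * inverse (d ^ k) = (d ^ k * inverse (d ^ k)) * (s ^ k * inverse (exp (d * s)))"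
      by (simp only: power_mult_distrib divide_inverse mult_ac)
    also have "d ^ k * inverse (d ^ k) = 1" using assms by simp
    finally show "(d * s) ^ k / exp (d * s) * inverse (d ^ k) = s ^ k * exp (- d * s)"
      by (simp only: exp_minus minus_mult_left[symmetric] mult_1_left)
  qed
  finally show ?thesis by (simp only: mult_zero_left)
qed

text \<open>Each entry of the exponential is at most a constant times a decaying exponential, which
  beats every power of \<open>s\<close>.\<close>

lemma tendsto_power_times_me_fun:
  assumes a: "\<alpha> \<in> carrier_mat 1 n" and T: "T \<in> carrier_mat n n" and t: "t \<in> carrier_mat n 1"
    and h: "hurwitz T"
  shows "((\<lambda>s. s ^ k * me_fun (\<alpha>, T, t) s) \<longlongrightarrow> 0) at_top"
proof -
  obtain K d where d: "d > 0"
    and K: "\<forall>x\<ge>0. \<forall>i<n. \<forall>j<n. \<bar>mat_exp (x \<cdot>\<^sub>m T) $$ (i, j)\<bar> \<le> K * exp (- d * x)"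
    using hurwitz_mat_exp_decay[OF T h] by blast
  have "((\<lambda>s. s ^ k * mat_exp (s \<cdot>\<^sub>m T) $$ (i, j)) \<longlongrightarrow> 0) at_top" if ij: "i < n" "j < n" for i j
  proof (rule Lim_null_comparison)
    show "((\<lambda>s. K * (s ^ k * exp (- d * s))) \<longlongrightarrow> 0) at_top"
      using tendsto_mult[OF tendsto_const[of K] tendsto_power_times_exp_neg[OF d, of k]] by simp
    show "\<forall>\<^sub>F s in at_top. norm (s ^ k * mat_exp (s \<cdot>\<^sub>m T) $$ (i, j)) \<le> K * (s ^ k * exp (- d * s))"
      using eventually_ge_at_top[of 0]
    proof eventually_elim
      case (elim s)
      have "s ^ k * \<bar>mat_exp (s \<cdot>\<^sub>m T) $$ (i, j)\<bar> \<le> s ^ k * (K * exp (- d * s))"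
        using K elim ij by (intro mult_left_mono) simp_all
      then show ?case using elim by (simp add: abs_mult mult.left_commute)
    qed
  qed
  then have "((\<lambda>s. \<Sum>j<n. \<Sum>i<n. \<alpha> $$ (0, i) * (s ^ k * mat_exp (s \<cdot>\<^sub>m T) $$ (i, j)) * t $$ (j, 0))
      \<longlongrightarrow> (\<Sum>j<n. \<Sum>i<n. \<alpha> $$ (0, i) * 0 * t $$ (j, 0))) at_top"
    by (intro tendsto_sum tendsto_mult tendsto_const) auto
  then show ?thesis
    by (simp add: me_fun_eq_sum[OF a T t] sum_distrib_left ac_simps)
qed

text \<open>Iterated integration by parts, for any sequence in which each \<open>g m\<close> is
  minus the derivative of the next member.\<close>

lemma antiderivative_power_times:
  fixes g :: "nat \<Rightarrow> real \<Rightarrow> real"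
  assumes "\<And>m x. (g (Suc m) has_real_derivative - g m x) (at x)"
  shows "((\<lambda>s. \<Sum>l\<le>h. fact h / fact l * s ^ l * g (Suc (h - l)) s) has_real_derivative
          - (x ^ h * g 0 x)) (at x)"
  using assms
proof (induction h arbitrary: g)
  case 0
  then show ?case by simp
next
  case (Suc h)
  \<comment> \<open>The top term is set aside, and the rest is \<open>Suc h\<close> times the sum
    for \<open>h\<close> with the family shifted by one; hence \<open>g\<close> is arbitrary in the
    induction. The product rule on the top term cancels the contribution of that rest.\<close>
  have "(\<lambda>s. \<Sum>l\<le>Suc h. fact (Suc h) / fact l * s ^ l * g (Suc (Suc h - l)) s)
      = (\<lambda>s. real (Suc h) * (\<Sum>l\<le>h. fact h / fact l * s ^ l * g (Suc (Suc (h - l))) s) + s ^ Suc h * g 1 s)"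
    by (auto simp: fun_eq_iff sum_distrib_left Suc_diff_le intro!: sum.cong)
  moreover have "((\<lambda>s. s ^ Suc h) has_real_derivative real (Suc h) * x ^ h) (at x)"
    using DERIV_pow[of "Suc h" x] by (simp del: power_Suc)
  then have "((\<lambda>s. s ^ Suc h * g 1 s) has_real_derivative real (Suc h) * x ^ h * g 1 x + - g 0 x * x ^ Suc h) (at x)"
    using Suc.prems[of 0 x] by (intro DERIV_mult) simp_all
  then have "((\<lambda>s. real (Suc h) * (\<Sum>l\<le>h. fact h / fact l * s ^ l * g (Suc (Suc (h - l))) s) + s ^ Suc h * g 1 s) has_real_derivative
      real (Suc h) * - (x ^ h * g 1 x) + (real (Suc h) * x ^ h * g 1 x + - g 0 x * x ^ Suc h)) (at x)"
    using Suc.IH[of "\<lambda>m. g (Suc m)", OF Suc.prems] by (intro DERIV_add DERIV_cmult) simp_all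
  ultimately show ?case by (simp add: algebra_simps)
qed

text \<open>By linearity in the column vector, the bracket of the theorem takes the shape of the sum
  in \<open>antiderivative_power_times\<close>.\<close>

lemma me_fun_neg_inv_sum:
  assumes a: "\<alpha> \<in> carrier_mat 1 n" and T: "T \<in> carrier_mat n n" and t: "t \<in> carrier_mat n 1"
    and h: "hurwitz T"
  shows "(\<alpha> * (mat_exp (y \<cdot>\<^sub>m T) * neg_inv_sum T h y) * t) $$ (0, 0)
    = (\<Sum>l\<le>h. fact h / fact l * y ^ l * me_fun (\<alpha>, T, mat_inv (- T) ^\<^sub>m Suc (h - l) * t) y)"
proof -
  let ?B = "mat_inv (- T)"
  let ?N = "neg_inv_sum T h y"
  let ?E = "mat_exp (y \<cdot>\<^sub>m T)"
  have B: "?B \<in> carrier_mat n n" by (rule hurwitz_mat_inv[OF T h])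
  have N: "?N \<in> carrier_mat n n" using T by (simp add: neg_inv_sum_def)
  have E: "?E \<in> carrier_mat n n" using T by simp
  have Nt: "(?N * t) $$ (j, 0) = (\<Sum>l\<le>h. fact h / fact l * y ^ l * (?B ^\<^sub>m Suc (h - l) * t) $$ (j, 0))"
    if j: "j < n" for j
  proof -
    have "(?N * t) $$ (j, 0) = (\<Sum>m<n. ?N $$ (j, m) * t $$ (m, 0))"
      using j by (intro index_mult_mat_sum[OF N t]) auto
    also have "\<dots> = (\<Sum>m<n. \<Sum>l\<le>h. fact h / fact l * y ^ l * ((?B ^\<^sub>m Suc (h - l)) $$ (j, m) * t $$ (m, 0)))"
      using j T by (intro sum.cong refl)
        (simp add: neg_inv_sum_def sum_distrib_right atLeast0AtMost mult.assoc del: pow_mat.simps)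
    also have "\<dots> = (\<Sum>l\<le>h. fact h / fact l * y ^ l * (\<Sum>m<n. (?B ^\<^sub>m Suc (h - l)) $$ (j, m) * t $$ (m, 0)))"
      by (subst sum.swap) (simp add: sum_distrib_left del: pow_mat.simps)
    also have "\<dots> = (\<Sum>l\<le>h. fact h / fact l * y ^ l * (?B ^\<^sub>m Suc (h - l) * t) $$ (j, 0))"
      using j B by (intro sum.cong refl, subst index_mult_mat_sum[OF _ t]) (auto simp del: pow_mat.simps)
    finally show ?thesis .
  qed
  have "\<alpha> * (?E * ?N) * t = \<alpha> * ?E * (?N * t)"
    using a E N t by (simp add: assoc_mult_mat[of _ 1 n _ n _ n] assoc_mult_mat[of _ 1 n _ n _ 1]
        assoc_mult_mat[of _ n n _ n _ 1])
  then have "(\<alpha> * (?E * ?N) * t) $$ (0, 0) = me_fun (\<alpha>, T, ?N * t) y"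
    by (simp add: me_fun_def)
  also have "\<dots> = (\<Sum>j<n. \<Sum>i<n. \<Sum>l\<le>h. fact h / fact l * y ^ l *
      (\<alpha> $$ (0, i) * ?E $$ (i, j) * (?B ^\<^sub>m Suc (h - l) * t) $$ (j, 0)))"
    unfolding me_fun_eq_sum[OF a T mult_carrier_mat[OF N t]]
    by (intro sum.cong refl) (simp add: Nt sum_distrib_left ac_simps del: pow_mat.simps index_mult_mat(1))
  also have "\<dots> = (\<Sum>j<n. \<Sum>l\<le>h. \<Sum>i<n. fact h / fact l * y ^ l *
      (\<alpha> $$ (0, i) * ?E $$ (i, j) * (?B ^\<^sub>m Suc (h - l) * t) $$ (j, 0)))"
    by (intro sum.cong refl sum.swap)
  also have "\<dots> = (\<Sum>l\<le>h. \<Sum>j<n. \<Sum>i<n. fact h / fact l * y ^ l *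
      (\<alpha> $$ (0, i) * ?E $$ (i, j) * (?B ^\<^sub>m Suc (h - l) * t) $$ (j, 0)))"
    by (rule sum.swap)
  also have "\<dots> = (\<Sum>l\<le>h. fact h / fact l * y ^ l * me_fun (\<alpha>, T, ?B ^\<^sub>m Suc (h - l) * t) y)"
    using B t by (intro sum.cong refl, subst me_fun_eq_sum[OF a T])
      (auto simp: sum_distrib_left simp del: pow_mat.simps)
  finally show ?thesis .
qed

text \<open>The fundamental theorem on the half line, applied to the antiderivative
  \<open>- \<Psi>\<close>, which tends to 0. The sign of the value is recorded too:
  \<open>ennreal\<close> sends negative reals to 0, and the real value has to be recovered
  later.\<close>

lemma me_fun_tail_moment:
  assumes a: "\<alpha> \<in> carrier_mat 1 n" and T: "T \<in> carrier_mat n n" and t: "t \<in> carrier_mat n 1"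
    and h: "hurwitz T" and nonneg: "\<And>x. x \<ge> 0 \<Longrightarrow> me_fun (\<alpha>, T, t) x \<ge> 0" and y: "y \<ge> 0"
  shows "(\<integral>\<^sup>+s. ennreal (s ^ h * me_fun (\<alpha>, T, t) s) * indicator {y..} s \<partial>lborel)
      = ennreal ((\<alpha> * (mat_exp (y \<cdot>\<^sub>m T) * neg_inv_sum T h y) * t) $$ (0, 0))" (is "?I = ennreal ?V")
    and "(\<alpha> * (mat_exp (y \<cdot>\<^sub>m T) * neg_inv_sum T h y) * t) $$ (0, 0) \<ge> 0"
proof -
  let ?B = "mat_inv (- T)"
  have B: "?B \<in> carrier_mat n n" and TB: "- T * ?B = 1\<^sub>m n" by (rule hurwitz_mat_inv[OF T h])+
  define g where "g m = me_fun (\<alpha>, T, ?B ^\<^sub>m m * t)" for m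
  define \<Psi> where "\<Psi> s = (\<Sum>l\<le>h. fact h / fact l * s ^ l * g (Suc (h - l)) s)" for s
  have Bm: "?B ^\<^sub>m m * t \<in> carrier_mat n 1" for m by (intro mult_carrier_mat[OF pow_carrier_mat[OF B] t])
  have g0: "g 0 = me_fun (\<alpha>, T, t)" using B t by (simp add: g_def)
  have V: "?V = \<Psi> y"
    unfolding \<Psi>_def g_def by (rule me_fun_neg_inv_sum[OF a T t h])
  have "(g (Suc m) has_real_derivative - g m x) (at x)" for m x
  proof -
    \<comment> \<open>\<open>- T\<close> cancels one factor of its inverse, so the derivative of
      \<open>g (Suc m)\<close> is \<open>- g m\<close>.\<close>
    have "- T * (?B ^\<^sub>m Suc m * t) = - T * (?B * (?B ^\<^sub>m m * t))"
      by (simp only: pow_mat_Suc_left[OF B] assoc_mult_mat[OF B pow_carrier_mat[OF B] t])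
    also have "\<dots> = (- T * ?B) * (?B ^\<^sub>m m * t)"
      using T by (intro assoc_mult_mat[OF _ B Bm, symmetric]) simp
    also have "\<dots> = ?B ^\<^sub>m m * t" unfolding TB by (rule left_mult_one_mat[OF Bm])
    finally have "- (T * (?B ^\<^sub>m Suc m * t)) = ?B ^\<^sub>m m * t"
      using T B by (simp add: uminus_mult_left_mat)
    then have "T * (?B ^\<^sub>m Suc m * t) = - (?B ^\<^sub>m m * t)"
      by (metis uminus_uminus_mat)
    then show ?thesis
      unfolding g_def using me_fun_deriv[OF a T Bm, of "Suc m" x] me_fun_uminus[OF a T Bm, of m x]
      by simp
  qed
  then have D: "(\<Psi> has_real_derivative - (x ^ h * g 0 x)) (at x)" for x
    unfolding \<Psi>_def by (rule antiderivative_power_times)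
  have "((\<lambda>s. \<Sum>l\<le>h. fact h / fact l * (s ^ l * g (Suc (h - l)) s)) \<longlongrightarrow> (\<Sum>l\<le>h. fact h / fact l * 0)) at_top"
    unfolding g_def by (intro tendsto_sum tendsto_mult tendsto_const tendsto_power_times_me_fun[OF a T Bm h])
  then have lim: "(\<Psi> \<longlongrightarrow> 0) at_top" by (simp add: \<Psi>_def[abs_def] mult.assoc)
  \<comment> \<open>Nonnegativity of the integrand makes \<open>\<Psi>\<close> decrease beyond
    \<open>y\<close>; as its limit is 0, \<open>\<Psi> y\<close> is nonnegative.\<close>
  have mono: "\<Psi> s \<le> \<Psi> y" if "s \<ge> y" for s
  proof (rule DERIV_nonpos_imp_nonincreasing[OF that])
    fix x assume "y \<le> x" "x \<le> s"
    then have "- (x ^ h * g 0 x) \<le> 0" using nonneg y by (simp add: g0)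
    then show "\<exists>d. (\<Psi> has_real_derivative d) (at x) \<and> d \<le> 0" using D by blast
  qed
  have "0 \<le> \<Psi> y"
    by (rule tendsto_upperbound[OF lim]) (auto intro!: eventually_mono[OF eventually_ge_at_top[of y]] mono)
  then show "0 \<le> ?V" using V by simp
  have "?I = ennreal (0 - - \<Psi> y)"
  proof (rule nn_integral_FTC_atLeast)
    show "(\<lambda>s. s ^ h * me_fun (\<alpha>, T, t) s) \<in> borel_measurable borel"
      using borel_measurable_me_fun[OF a T t] by measurable
    show "((\<lambda>s. - \<Psi> s) has_real_derivative x ^ h * me_fun (\<alpha>, T, t) x) (at x)" for x
      using DERIV_minus[OF D[of x]] by (simp add: g0)
    show "0 \<le> x ^ h * me_fun (\<alpha>, T, t) x" if "y \<le> x" for x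
      using nonneg[of x] that y by simp
    show "((\<lambda>s. - \<Psi> s) \<longlongrightarrow> 0) at_top" using tendsto_minus[OF lim] by simp
  qed
  then show "?I = ennreal ?V" using V by simp
qed

section \<open>Convolutions\<close>

lemma sum_lessThan_add:
  fixes f :: "nat \<Rightarrow> 'a::comm_monoid_add"
  shows "sum f {..<n + m} = sum f {..<n} + (\<Sum>i<m. f (n + i))"
  by (induction m) (simp_all add: add.assoc)

lemma sum_lessThan_mult:
  fixes f :: "nat \<Rightarrow> 'a::comm_monoid_add"
  shows "sum f {..<p * K} = (\<Sum>b<K. \<Sum>q<p. f (p * b + q))"
proof (induction K)
  case (Suc K)
  have "p * Suc K = p * K + p" by simp
  then show ?case using Suc by (simp only: sum_lessThan_add sum.lessThan_Suc)
qed simp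

text \<open>The upper right block stays existential, since only the lower right block is read off
  afterwards.\<close>

lemma pow_four_block_upper:
  fixes A :: "real mat"
  assumes A: "A \<in> carrier_mat n n" and B: "B \<in> carrier_mat n m" and D: "D \<in> carrier_mat m m"
  shows "\<exists>X\<in>carrier_mat n m. four_block_mat A B (0\<^sub>m m n) D ^\<^sub>m k = four_block_mat (A ^\<^sub>m k) X (0\<^sub>m m n) (D ^\<^sub>m k)"
proof (induction k)
  case 0
  then show ?case using A D by (intro bexI[of _ "0\<^sub>m n m"]) auto
next
  case (Suc k)
  then obtain X where X: "X \<in> carrier_mat n m"
    and eq: "four_block_mat A B (0\<^sub>m m n) D ^\<^sub>m k = four_block_mat (A ^\<^sub>m k) X (0\<^sub>m m n) (D ^\<^sub>m k)"
    by blast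
  have "four_block_mat A B (0\<^sub>m m n) D ^\<^sub>m Suc k
      = four_block_mat (A ^\<^sub>m k) X (0\<^sub>m m n) (D ^\<^sub>m k) * four_block_mat A B (0\<^sub>m m n) D"
    using eq by simp
  also have "\<dots> = four_block_mat (A ^\<^sub>m k * A + X * 0\<^sub>m m n) (A ^\<^sub>m k * B + X * D)
      (0\<^sub>m m n * A + D ^\<^sub>m k * 0\<^sub>m m n) (0\<^sub>m m n * B + D ^\<^sub>m k * D)"
    by (rule mult_four_block_mat[of _ n n _ m _ m _ _ n _ m]) (use A B D X in auto)
  also have "\<dots> = four_block_mat (A ^\<^sub>m Suc k) (A ^\<^sub>m k * B + X * D) (0\<^sub>m m n) (D ^\<^sub>m Suc k)"
    using A B D X right_add_zero_mat[of "A ^\<^sub>m k * A" n n] left_add_zero_mat[of "D ^\<^sub>m k * D" m m]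
    by auto
  finally show ?case using A B D X by (intro bexI[of _ "A ^\<^sub>m k * B + X * D"]) auto
qed

lemma mat_exp_four_block_lower_right:
  assumes A: "A \<in> carrier_mat n n" and B: "B \<in> carrier_mat n m" and D: "D \<in> carrier_mat m m"
    and ij: "i < m" "j < m"
  shows "mat_exp (x \<cdot>\<^sub>m four_block_mat A B (0\<^sub>m m n) D) $$ (n + i, n + j) = mat_exp (x \<cdot>\<^sub>m D) $$ (i, j)"
proof -
  let ?F = "four_block_mat A B (0\<^sub>m m n) D"
  have F: "?F \<in> carrier_mat (n + m) (n + m)" using A D by simp
  have "(?F ^\<^sub>m k) $$ (n + i, n + j) = (D ^\<^sub>m k) $$ (i, j)" for k
  proof -
    obtain X where "?F ^\<^sub>m k = four_block_mat (A ^\<^sub>m k) X (0\<^sub>m m n) (D ^\<^sub>m k)"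
      using pow_four_block_upper[OF A B D] by blast
    then show ?thesis using A D ij by simp
  qed
  then show ?thesis
    using ij by (simp add: mat_exp_entry[OF F] mat_exp_entry[OF D])
qed

text \<open>The recursion step of \<open>conv_triple\<close>, isolated for two arbitrary triples so
  that the first one may also be a block triple carrying a power of the variable.\<close>

fun conv2 :: "me_triple \<Rightarrow> me_triple \<Rightarrow> me_triple" where
  "conv2 (\<alpha>, T, t) (\<alpha>', T', t') =
    (append_cols_mat \<alpha> (0\<^sub>m 1 (dim_col \<alpha>')),
     four_block_mat T (t * \<alpha>') (0\<^sub>m (dim_row T') (dim_col T)) T',
     0\<^sub>m (dim_row T) 1 @\<^sub>r t')"

text \<open>The invariant kept by convolution and by multiplication with powers. Total mass 1 is
  absent because x^k times a density is in general not normalised.\<close>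

definition me_ok :: "me_triple \<Rightarrow> bool" where
  "me_ok tr \<longleftrightarrow> (case tr of (\<alpha>, T, t) \<Rightarrow>
     (\<exists>n. \<alpha> \<in> carrier_mat 1 n \<and> T \<in> carrier_mat n n \<and> t \<in> carrier_mat n 1) \<and>
     hurwitz T \<and> (\<forall>x\<ge>0. me_fun (\<alpha>, T, t) x \<ge> 0))"

locale me_pair =
  fixes \<alpha> T t \<alpha>' T' t' :: "real mat" and n m :: nat
  assumes a: "\<alpha> \<in> carrier_mat 1 n" and T: "T \<in> carrier_mat n n" and t: "t \<in> carrier_mat n 1"
    and a': "\<alpha>' \<in> carrier_mat 1 m" and T': "T' \<in> carrier_mat m m" and t': "t' \<in> carrier_mat m 1"
begin

abbreviation F where "F \<equiv> four_block_mat T (t * \<alpha>') (0\<^sub>m m n) T'"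

lemma F: "F \<in> carrier_mat (n + m) (n + m)"
  using T T' by simp

lemma conv2_eq: "conv2 (\<alpha>, T, t) (\<alpha>', T', t') = (append_cols_mat \<alpha> (0\<^sub>m 1 m), F, 0\<^sub>m n 1 @\<^sub>r t')"
  using a T t a' T' t' by (auto simp: carrier_matD)

lemma conv2_carrier:
  "append_cols_mat \<alpha> (0\<^sub>m 1 m) \<in> carrier_mat 1 (n + m)" "0\<^sub>m n 1 @\<^sub>r t' \<in> carrier_mat (n + m) 1"
  using a t' by (auto simp: append_cols_mat_def)

definition rowfun :: "nat \<Rightarrow> real \<Rightarrow> real" where
  "rowfun i x = (\<Sum>l<n. \<alpha> $$ (0, l) * mat_exp (x \<cdot>\<^sub>m T) $$ (l, i))"

text \<open>For \<open>i < n\<close>, entry \<open>i\<close> of the function W of the overview;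
  \<open>rowfun\<close> is correspondingly the row vector \<alpha> e^(Tx).\<close>

definition colfun :: "nat \<Rightarrow> real \<Rightarrow> real" where
  "colfun i x = (\<Sum>j<m. mat_exp (x \<cdot>\<^sub>m F) $$ (i, n + j) * t' $$ (j, 0))"

lemma me_fun_rowfun: "me_fun (\<alpha>, T, t) x = (\<Sum>i<n. rowfun i x * t $$ (i, 0))"
  by (simp add: me_fun_eq_sum[OF a T t] rowfun_def sum_distrib_right)

text \<open>The zeros in the padded row and column vectors select the upper right block of the block
  exponential.\<close>

lemma me_fun_conv2: "me_fun (conv2 (\<alpha>, T, t) (\<alpha>', T', t')) x = (\<Sum>i<n. \<alpha> $$ (0, i) * colfun i x)"
proof -
  let ?a = "append_cols_mat \<alpha> (0\<^sub>m 1 m)" and ?t = "0\<^sub>m n 1 @\<^sub>r t'"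
  have a0: "?a $$ (0, i) = (if i < n then \<alpha> $$ (0, i) else 0)" if "i < n + m" for i
    using that a by (auto simp: append_cols_mat_def)
  have t0: "?t $$ (j, 0) = (if j < n then 0 else t' $$ (j - n, 0))" if "j < n + m" for j
    using that t' by (auto simp: append_rows_def)
  have "me_fun (?a, F, ?t) x
      = (\<Sum>j<n + m. \<Sum>i<n + m. ?a $$ (0, i) * mat_exp (x \<cdot>\<^sub>m F) $$ (i, j) * ?t $$ (j, 0))"
    by (rule me_fun_eq_sum[OF conv2_carrier(1) F conv2_carrier(2)])
  also have "\<dots> = (\<Sum>j<m. \<Sum>i<n. \<alpha> $$ (0, i) * mat_exp (x \<cdot>\<^sub>m F) $$ (i, n + j) * t' $$ (j, 0))"
    unfolding sum_lessThan_add by (simp add: a0 t0 del: One_nat_def)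
  also have "\<dots> = (\<Sum>i<n. \<alpha> $$ (0, i) * colfun i x)"
    by (subst sum.swap) (simp add: colfun_def sum_distrib_left mult.assoc)
  finally show ?thesis by (simp only: conv2_eq)
qed

lemma rowfun_deriv:
  assumes "i < n"
  shows "(rowfun i has_real_derivative (\<Sum>l<n. rowfun l x * T $$ (l, i))) (at x)"
proof -
  have "((\<lambda>x. \<Sum>l<n. \<alpha> $$ (0, l) * mat_exp (x \<cdot>\<^sub>m T) $$ (l, i)) has_real_derivative
      (\<Sum>l<n. \<alpha> $$ (0, l) * (\<Sum>q<n. mat_exp (x \<cdot>\<^sub>m T) $$ (l, q) * T $$ (q, i)))) (at x)"
    using assms by (intro DERIV_sum DERIV_cmult mat_exp_entry_deriv_right[OF T]) auto
  moreover have "(\<Sum>l<n. \<alpha> $$ (0, l) * (\<Sum>q<n. mat_exp (x \<cdot>\<^sub>m T) $$ (l, q) * T $$ (q, i)))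
      = (\<Sum>l<n. rowfun l x * T $$ (l, i))"
    unfolding rowfun_def sum_distrib_left sum_distrib_right mult.assoc by (rule sum.swap)
  ultimately show ?thesis by (simp add: rowfun_def[abs_def])
qed

text \<open>Writing g' for the function of the second triple, this is W' = T W + t g'. The upper
  rows of \<open>F\<close> are \<open>T\<close> and \<open>t * \<alpha>'\<close>, and the lower
  right block of the exponential is that of \<open>T'\<close>, which produces g'.\<close>

lemma colfun_deriv:
  assumes i: "i < n"
  shows "(colfun i has_real_derivative
      (\<Sum>l<n. T $$ (i, l) * colfun l x) + t $$ (i, 0) * me_fun (\<alpha>', T', t') x) (at x)"
proof -
  let ?E = "\<lambda>l j. mat_exp (x \<cdot>\<^sub>m F) $$ (l, n + j)"
  have "((\<lambda>x. \<Sum>j<m. mat_exp (x \<cdot>\<^sub>m F) $$ (i, n + j) * t' $$ (j, 0)) has_real_derivative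
      (\<Sum>j<m. (\<Sum>l<n + m. F $$ (i, l) * ?E l j) * t' $$ (j, 0))) (at x)"
    using i by (intro DERIV_sum DERIV_cmult_right mat_exp_entry_deriv_left[OF F]) auto
  moreover have "(\<Sum>j<m. (\<Sum>l<n + m. F $$ (i, l) * ?E l j) * t' $$ (j, 0))
      = (\<Sum>l<n + m. F $$ (i, l) * (\<Sum>j<m. ?E l j * t' $$ (j, 0)))"
    unfolding sum_distrib_left sum_distrib_right mult.assoc by (rule sum.swap)
  moreover have "\<dots> = (\<Sum>l<n. T $$ (i, l) * colfun l x)
      + (\<Sum>l<m. t $$ (i, 0) * \<alpha>' $$ (0, l) * (\<Sum>j<m. mat_exp (x \<cdot>\<^sub>m T') $$ (l, j) * t' $$ (j, 0)))"
  proof -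
    have ta: "(t * \<alpha>') $$ (i, l) = t $$ (i, 0) * \<alpha>' $$ (0, l)" if "l < m" for l
      using index_mult_mat_sum[OF t a' i that] by simp
    have "F $$ (i, l) = T $$ (i, l)" if "l < n" for l using i T T' that by simp
    moreover have "F $$ (i, n + l) = t $$ (i, 0) * \<alpha>' $$ (0, l)" if "l < m" for l
      using i T T' that ta by (simp del: index_mult_mat(1))
    ultimately show ?thesis
      unfolding sum_lessThan_add
      using mat_exp_four_block_lower_right[OF T mult_carrier_mat[OF t a'] T'] by (simp add: colfun_def)
  qed
  moreover have "(\<Sum>l<m. t $$ (i, 0) * \<alpha>' $$ (0, l) * (\<Sum>j<m. mat_exp (x \<cdot>\<^sub>m T') $$ (l, j) * t' $$ (j, 0)))
      = t $$ (i, 0) * me_fun (\<alpha>', T', t') x"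
    unfolding me_fun_eq_sum[OF a' T' t'] sum_distrib_left mult.assoc by (rule sum.swap)
  ultimately show ?thesis by (simp add: colfun_def[abs_def])
qed

text \<open>With R = \<alpha> e^(Tx), the product rule gives - R T W + R (T W + t g'), where R is
  taken at v - u; the terms with T cancel and R t is the first function.\<close>

lemma convolution_antiderivative:
  "((\<lambda>u. \<Sum>i<n. rowfun i (v - u) * colfun i u) has_real_derivative
      me_fun (\<alpha>, T, t) (v - u) * me_fun (\<alpha>', T', t') u) (at u)"
proof -
  let ?R = "\<lambda>i. rowfun i (v - u)" and ?C = "\<lambda>i. colfun i u"
  have "((\<lambda>u. rowfun i (v - u)) has_real_derivative - (\<Sum>l<n. ?R l * T $$ (l, i))) (at u)" if "i < n" for i
  proof -
    have "((\<lambda>u. rowfun i (v - u)) has_real_derivative (\<Sum>l<n. ?R l * T $$ (l, i)) * - 1) (at u)"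
      by (rule DERIV_chain2[where g = "\<lambda>u. v - u"], rule rowfun_deriv[OF that])
        (auto intro!: derivative_eq_intros)
    then show ?thesis by simp
  qed
  then have "((\<lambda>u. \<Sum>i<n. rowfun i (v - u) * colfun i u) has_real_derivative
      (\<Sum>i<n. - (\<Sum>l<n. ?R l * T $$ (l, i)) * ?C i
        + ((\<Sum>l<n. T $$ (i, l) * ?C l) + t $$ (i, 0) * me_fun (\<alpha>', T', t') u) * ?R i)) (at u)"
    by (intro DERIV_sum DERIV_mult colfun_deriv) auto
  moreover have "(\<Sum>i<n. - (\<Sum>l<n. ?R l * T $$ (l, i)) * ?C i
        + ((\<Sum>l<n. T $$ (i, l) * ?C l) + t $$ (i, 0) * me_fun (\<alpha>', T', t') u) * ?R i)
      = - (\<Sum>i<n. \<Sum>l<n. ?R l * T $$ (l, i) * ?C i) + (\<Sum>i<n. \<Sum>l<n. ?R i * T $$ (i, l) * ?C l)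
        + (\<Sum>i<n. ?R i * t $$ (i, 0)) * me_fun (\<alpha>', T', t') u"
    by (simp add: sum.distrib sum_subtractf sum_negf sum_distrib_left sum_distrib_right algebra_simps)
  moreover have "(\<Sum>i<n. \<Sum>l<n. ?R l * T $$ (l, i) * ?C i) = (\<Sum>i<n. \<Sum>l<n. ?R i * T $$ (i, l) * ?C l)"
    by (rule sum.swap)
  ultimately show ?thesis by (simp add: me_fun_rowfun)
qed

lemma rowfun_0: "i < n \<Longrightarrow> rowfun i 0 = \<alpha> $$ (0, i)"
  by (simp add: rowfun_def mat_exp_entry_0[OF T] if_distrib cong: if_cong)

lemma colfun_0: "i < n \<Longrightarrow> colfun i 0 = 0"
  by (simp add: colfun_def mat_exp_entry_0[OF F])

lemma convolution:
  assumes g: "\<And>x. x \<ge> 0 \<Longrightarrow> me_fun (\<alpha>, T, t) x \<ge> 0" and g': "\<And>x. x \<ge> 0 \<Longrightarrow> me_fun (\<alpha>', T', t') x \<ge> 0"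
    and v: "v \<ge> 0"
  shows "(\<integral>\<^sup>+u. ennreal (me_fun (\<alpha>, T, t) (v - u) * me_fun (\<alpha>', T', t') u) * indicator {0..v} u \<partial>lborel)
      = ennreal (me_fun (conv2 (\<alpha>, T, t) (\<alpha>', T', t')) v)"
    and "me_fun (conv2 (\<alpha>, T, t) (\<alpha>', T', t')) v \<ge> 0"
proof -
  let ?H = "\<lambda>u. \<Sum>i<n. rowfun i (v - u) * colfun i u"
  \<comment> \<open>At \<open>u = v\<close> the row factor is \<open>\<alpha>\<close> itself; at
    \<open>u = 0\<close> the column factor vanishes, because the upper right block of the identity
    is 0.\<close>
  have H: "?H v = me_fun (conv2 (\<alpha>, T, t) (\<alpha>', T', t')) v" "?H 0 = 0"
    by (simp_all add: me_fun_conv2 rowfun_0 colfun_0 del: conv2.simps)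
  have nn: "0 \<le> me_fun (\<alpha>, T, t) (v - u) * me_fun (\<alpha>', T', t') u" if "0 \<le> u" "u \<le> v" for u
    using g[of "v - u"] g'[of u] that by simp
  \<comment> \<open>The derivative of the antiderivative is nonnegative on the interval, so the
    convolution is nonnegative.\<close>
  have "?H 0 \<le> ?H v"
    using nn convolution_antiderivative by (intro DERIV_nonneg_imp_nondecreasing[OF v]) blast
  then show "me_fun (conv2 (\<alpha>, T, t) (\<alpha>', T', t')) v \<ge> 0" using H by simp
  have [measurable]: "me_fun (\<alpha>, T, t) \<in> borel_measurable borel" "me_fun (\<alpha>', T', t') \<in> borel_measurable borel"
    by (rule borel_measurable_me_fun[OF a T t] borel_measurable_me_fun[OF a' T' t'])+
  have "(\<integral>\<^sup>+u. ennreal (me_fun (\<alpha>, T, t) (v - u) * me_fun (\<alpha>', T', t') u) * indicator {0..v} u \<partial>lborel)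
      = ennreal (?H v - ?H 0)"
    by (rule nn_integral_FTC_Icc[OF _ _ _ v]) (use nn convolution_antiderivative in \<open>auto\<close>)
  then show "(\<integral>\<^sup>+u. ennreal (me_fun (\<alpha>, T, t) (v - u) * me_fun (\<alpha>', T', t') u) * indicator {0..v} u \<partial>lborel)
      = ennreal (me_fun (conv2 (\<alpha>, T, t) (\<alpha>', T', t')) v)"
    using H by simp
qed

end

lemma me_ok_conv2:
  assumes "me_ok tr" "me_ok tr'"
  shows "me_ok (conv2 tr tr')"
proof -
  obtain \<alpha> T t where tr: "tr = (\<alpha>, T, t)" by (cases tr)
  obtain \<alpha>' T' t' where tr': "tr' = (\<alpha>', T', t')" by (cases tr')
  obtain n m where "me_pair \<alpha> T t \<alpha>' T' t' n m"
    using assms unfolding tr tr' me_ok_def me_pair_def by auto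
  then interpret me_pair \<alpha> T t \<alpha>' T' t' n m .
  have "hurwitz F"
    using assms unfolding tr tr' me_ok_def
    by (intro hurwitz_four_block[OF T mult_carrier_mat[OF t a'] T']) auto
  moreover have "me_fun (conv2 tr tr') x \<ge> 0" if "x \<ge> 0" for x
    using assms that unfolding tr tr' me_ok_def by (intro convolution(2)) auto
  ultimately show ?thesis
    using conv2_carrier F unfolding tr tr' me_ok_def conv2_eq by auto
qed

lemma nn_integral_conv2:
  assumes "me_ok tr" "me_ok tr'" and v: "v \<ge> 0"
  shows "(\<integral>\<^sup>+u. ennreal (me_fun tr (v - u) * me_fun tr' u) * indicator {0..v} u \<partial>lborel)
      = ennreal (me_fun (conv2 tr tr') v)"
proof -
  obtain \<alpha> T t where tr: "tr = (\<alpha>, T, t)" by (cases tr)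
  obtain \<alpha>' T' t' where tr': "tr' = (\<alpha>', T', t')" by (cases tr')
  obtain n m where "me_pair \<alpha> T t \<alpha>' T' t' n m"
    using assms unfolding tr tr' me_ok_def me_pair_def by auto
  then interpret me_pair \<alpha> T t \<alpha>' T' t' n m .
  show ?thesis
    using assms unfolding tr tr' me_ok_def by (intro convolution(1)) auto
qed

section \<open>Multiplication by powers\<close>

text \<open>The power series form, in which the block construction is compared with a power of
  \<open>x\<close> coefficient by coefficient.\<close>

lemma me_fun_sums:
  assumes a: "\<alpha> \<in> carrier_mat 1 n" and T: "T \<in> carrier_mat n n" and t: "t \<in> carrier_mat n 1"
  shows "(\<lambda>k. (\<alpha> * T ^\<^sub>m k * t) $$ (0, 0) / fact k * x ^ k) sums me_fun (\<alpha>, T, t) x"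
proof -
  have "(\<lambda>k. (T ^\<^sub>m k) $$ (i, j) / fact k * x ^ k) sums mat_exp (x \<cdot>\<^sub>m T) $$ (i, j)"
    if "i < n" "j < n" for i j
    unfolding mat_exp_entry[OF T that]
    by (rule summable_sums[OF summable_norm_cancel[OF summable_mat_exp_entry[OF T that]]])
  then have "(\<lambda>k. \<Sum>j<n. \<Sum>i<n. \<alpha> $$ (0, i) * ((T ^\<^sub>m k) $$ (i, j) / fact k * x ^ k) * t $$ (j, 0))
      sums (\<Sum>j<n. \<Sum>i<n. \<alpha> $$ (0, i) * mat_exp (x \<cdot>\<^sub>m T) $$ (i, j) * t $$ (j, 0))"
    by (intro sums_sum sums_mult2 sums_mult) auto
  moreover have "(\<Sum>j<n. \<Sum>i<n. \<alpha> $$ (0, i) * ((T ^\<^sub>m k) $$ (i, j) / fact k * x ^ k) * t $$ (j, 0))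
      = (\<alpha> * T ^\<^sub>m k * t) $$ (0, 0) / fact k * x ^ k" for k
  proof -
    have Tk: "T ^\<^sub>m k \<in> carrier_mat n n" using T by simp
    have "(\<alpha> * T ^\<^sub>m k * t) $$ (0, 0) = (\<Sum>j<n. (\<Sum>i<n. \<alpha> $$ (0, i) * (T ^\<^sub>m k) $$ (i, j)) * t $$ (j, 0))"
      by (subst index_mult_mat_sum[OF mult_carrier_mat[OF a Tk] t])
        (auto intro!: sum.cong index_mult_mat_sum[OF a Tk])
    then show ?thesis by (simp add: sum_distrib_left sum_distrib_right sum_divide_distrib ac_simps)
  qed
  ultimately show ?thesis by (simp add: me_fun_eq_sum[OF a T t])
qed

lemma block_T_carrier: "T \<in> carrier_mat p p \<Longrightarrow> block_T T k lam \<in> carrier_mat (p * (k + 1)) (p * (k + 1))"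
  by (auto simp: block_T_def Let_def)

lemma block_alpha_carrier: "\<alpha> \<in> carrier_mat 1 p \<Longrightarrow> block_alpha \<alpha> k \<in> carrier_mat 1 (p * (k + 1))"
  by (auto simp: block_alpha_def Let_def)

lemma block_t_carrier: "t \<in> carrier_mat p 1 \<Longrightarrow> block_t t k \<in> carrier_mat (p * (k + 1)) 1"
  by (auto simp: block_t_def Let_def)

text \<open>Splitting off the last block row and column leaves a block upper triangular matrix with
  \<open>T\<close> in the lower right corner, so induction on \<open>k\<close> applies. Dimension 0
  is separate because block numbers are quotients by \<open>p\<close>.\<close>

lemma hurwitz_block_T:
  assumes T: "T \<in> carrier_mat p p" and h: "hurwitz T"
  shows "hurwitz (block_T T k 0)"
proof (cases "p = 0")
  case True
  then have "block_T T k 0 = T" using T by (intro eq_matI) (auto simp: block_T_def)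
  then show ?thesis using h by simp
next
  case False
  show ?thesis
  proof (induction k)
    case 0
    have "block_T T 0 0 = T" using T by (intro eq_matI) (auto simp: block_T_def Let_def)
    then show ?case using h by simp
  next
    case (Suc k)
    let ?q = "p * (k + 1)"
    \<comment> \<open>Only the shape of the upper right block matters, so it is read off from the
      full matrix.\<close>
    define X where "X = mat ?q p (\<lambda>(r, c). block_T T (Suc k) 0 $$ (r, ?q + c))"
    have X: "X \<in> carrier_mat ?q p" by (simp add: X_def)
    have "block_T T (Suc k) 0 = four_block_mat (block_T T k 0) X (0\<^sub>m p ?q) T" (is "?L = ?R")
    proof (rule eq_matI)
      show "dim_row ?L = dim_row ?R" "dim_col ?L = dim_col ?R"
        using T by (auto simp: block_T_def Let_def)
      fix r c assume "r < dim_row ?R" "c < dim_col ?R"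
      then have rc: "r < ?q + p" "c < ?q + p" using T by (auto simp: block_T_def Let_def)
      have lt: "m div p < k + 1 \<longleftrightarrow> m < ?q" for m
        using False by (simp add: div_less_iff_less_mult mult.commute)
      have ge: "m div p = k + 1 \<and> m mod p = m - ?q" if "\<not> m < ?q" "m < ?q + p" for m
      proof -
        have "m = ?q + (m - ?q)" "m - ?q < p" using that by auto
        then show ?thesis using False
          by (metis add.right_neutral div_less div_mult_self4 mod_less mod_mult_self4 mult.commute add.commute div_mult_self2 mod_mult_self2)
      qed
      show "?L $$ (r, c) = ?R $$ (r, c)"
      proof (cases "r < ?q")
        case True
        show ?thesis
        proof (cases "c < ?q")
          case c: True
          then show ?thesis using True rc T by (auto simp: block_T_def Let_def)
        next
          case False
          then show ?thesis using True rc T by (auto simp: X_def block_T_def Let_def)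
        qed
      next
        case r: False
        show ?thesis
        proof (cases "c < ?q")
          case c: True
          then have "c div p < k + 1" "r div p = k + 1" using lt ge r rc by auto
          then show ?thesis using r c rc T by (auto simp: block_T_def Let_def)
        next
          case c: False
          then show ?thesis using ge[OF r rc(1)] ge[OF c rc(2)] r rc T by (auto simp: block_T_def Let_def)
        qed
      qed
    qed
    then show ?case
      using hurwitz_four_block[OF block_T_carrier[OF T] X T Suc h] by simp
  qed
qed

text \<open>In the column numbered \<open>c\<close>, block row \<open>c div p\<close> holds a column
  of \<open>T\<close>, the block row above it holds a single 1, and all else is 0. In block column 0
  there is no block above.\<close>

lemma sum_block_col:
  fixes V :: "nat \<Rightarrow> real"
  assumes T: "T \<in> carrier_mat p p" and c: "c < p * (k + 1)"
  shows "(\<Sum>m<p * (k + 1). V m * block_T T k 0 $$ (m, c))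
    = (\<Sum>q<p. V (p * (c div p) + q) * T $$ (q, c mod p)) + (if c div p = 0 then 0 else V (p * (c div p - 1) + c mod p))"
proof -
  let ?\<beta> = "c div p" and ?\<gamma> = "c mod p"
  have p: "p > 0" using c by (cases p) auto
  have \<beta>: "?\<beta> < k + 1" using c p by (simp add: div_less_iff_less_mult mult.commute)
  have \<gamma>: "?\<gamma> < p" using p by simp
  have B: "block_T T k 0 $$ (p * b + q, c) = (if b = ?\<beta> then T $$ (q, ?\<gamma>) else if ?\<beta> = b + 1 then (if q = ?\<gamma> then 1 else 0) else 0)"
    if "b < k + 1" "q < p" for b q
  proof -
    have "p * b + q < p * b + p" using that by simp
    also have "\<dots> \<le> p * (k + 1)" using that by (metis Suc_eq_plus1 Suc_leI mult_Suc_right add.commute mult_le_mono2)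
    finally have "p * b + q < p * (k + 1)" .
    then show ?thesis using that c T \<gamma> by (auto simp: block_T_def Let_def)
  qed
  have "(\<Sum>m<p * (k + 1). V m * block_T T k 0 $$ (m, c))
      = (\<Sum>b<k + 1. \<Sum>q<p. V (p * b + q) * block_T T k 0 $$ (p * b + q, c))"
    by (rule sum_lessThan_mult)
  also have "\<dots> = (\<Sum>b<k + 1. (if b = ?\<beta> then (\<Sum>q<p. V (p * b + q) * T $$ (q, ?\<gamma>)) else 0)
      + (if ?\<beta> = b + 1 then V (p * b + ?\<gamma>) else 0))"
  proof (rule sum.cong[OF refl])
    fix b assume "b \<in> {..<k + 1}"
    then have "(\<Sum>q<p. V (p * b + q) * block_T T k 0 $$ (p * b + q, c))
      = (\<Sum>q<p. V (p * b + q) * (if b = ?\<beta> then T $$ (q, ?\<gamma>) else if ?\<beta> = b + 1 then (if q = ?\<gamma> then 1 else 0) else 0))"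
      by (intro sum.cong refl) (simp add: B)
    also have "\<dots> = (if b = ?\<beta> then (\<Sum>q<p. V (p * b + q) * T $$ (q, ?\<gamma>)) else 0)
      + (if ?\<beta> = b + 1 then V (p * b + ?\<gamma>) else 0)"
      using \<gamma> by (simp add: if_distrib[of "\<lambda>x. _ * x"] cong: if_cong)
    finally show "(\<Sum>q<p. V (p * b + q) * block_T T k 0 $$ (p * b + q, c)) = \<dots>" .
  qed
  also have "\<dots> = (\<Sum>q<p. V (p * ?\<beta> + q) * T $$ (q, ?\<gamma>)) + (\<Sum>b<k + 1. if ?\<beta> = b + 1 then V (p * b + ?\<gamma>) else 0)"
    using \<beta> by (simp add: sum.distrib del: sum.lessThan_Suc)
  also have "(\<Sum>b<k + 1. if ?\<beta> = b + 1 then V (p * b + ?\<gamma>) else 0) = (if ?\<beta> = 0 then 0 else V (p * (?\<beta> - 1) + ?\<gamma>))"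
  proof (cases "?\<beta>")
    case (Suc b')
    then have "(\<Sum>b<k + 1. if ?\<beta> = b + 1 then V (p * b + ?\<gamma>) else 0) = (\<Sum>b<k + 1. if b = b' then V (p * b + ?\<gamma>) else 0)"
      by (intro sum.cong) auto
    then show ?thesis using Suc \<beta> by (simp del: sum.lessThan_Suc)
  qed simp
  finally show ?thesis .
qed

text \<open>The block matrix is a diagonal part plus a commuting block shift, so moving
  \<open>b\<close> blocks to the right in \<open>n\<close> steps happens in
  \<open>n choose b\<close> ways. Blocks beyond \<open>n\<close> have coefficient 0, which makes
  truncated subtraction harmless.\<close>

lemma block_alpha_pow:
  assumes a: "\<alpha> \<in> carrier_mat 1 p" and T: "T \<in> carrier_mat p p" and c: "c < p * (k + 1)"
  shows "(block_alpha \<alpha> k * block_T T k 0 ^\<^sub>m n) $$ (0, c)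
    = real (n choose (c div p)) * (\<alpha> * T ^\<^sub>m (n - c div p)) $$ (0, c mod p)"
  using c
proof (induction n arbitrary: c)
  case 0
  have p: "p > 0" using 0 by (cases p) auto
  have "block_alpha \<alpha> k * block_T T k 0 ^\<^sub>m 0 = block_alpha \<alpha> k"
    using right_mult_one_mat[OF block_alpha_carrier[OF a, of k]] block_T_carrier[OF T, of k 0] by simp
  moreover have "\<alpha> * T ^\<^sub>m (0 - c div p) = \<alpha>" using right_mult_one_mat[OF a] T by simp
  moreover have "c div p = 0 \<longleftrightarrow> c < p" using p by (simp add: div_eq_0_iff)
  ultimately show ?case using a 0 by (auto simp: block_alpha_def Let_def binomial_eq_0)
next
  case (Suc n)
  let ?\<beta> = "c div p" and ?\<gamma> = "c mod p"
  let ?B = "block_T T k 0" and ?a = "block_alpha \<alpha> k"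
  define W where "W m q = (\<alpha> * T ^\<^sub>m m) $$ (0, q)" for m q
  define V where "V c = real (n choose (c div p)) * W (n - c div p) (c mod p)" for c
  have p: "p > 0" using Suc.prems by (cases p) auto
  have B: "?B \<in> carrier_mat (p * (k + 1)) (p * (k + 1))" by (rule block_T_carrier[OF T])
  have aB: "?a * ?B ^\<^sub>m n \<in> carrier_mat 1 (p * (k + 1))"
    by (rule mult_carrier_mat[OF block_alpha_carrier[OF a] pow_carrier_mat[OF B]])
  have W_Suc: "W (Suc m) q = (\<Sum>i<p. W m i * T $$ (i, q))" if "q < p" for m q
  proof -
    have "\<alpha> * T ^\<^sub>m Suc m = \<alpha> * T ^\<^sub>m m * T"
      using assoc_mult_mat[OF a pow_carrier_mat[OF T] T, of m] by simp
    then show ?thesis unfolding W_def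
      using index_mult_mat_sum[OF mult_carrier_mat[OF a pow_carrier_mat[OF T, of m]] T, of 0 q] that by simp
  qed
  have "?a * ?B ^\<^sub>m Suc n = ?a * ?B ^\<^sub>m n * ?B"
    using assoc_mult_mat[OF block_alpha_carrier[OF a] pow_carrier_mat[OF B] B, of n] by simp
  then have "(?a * ?B ^\<^sub>m Suc n) $$ (0, c) = (\<Sum>m<p * (k + 1). (?a * ?B ^\<^sub>m n) $$ (0, m) * ?B $$ (m, c))"
    using index_mult_mat_sum[OF aB B, of 0 c] Suc.prems by simp
  also have "\<dots> = (\<Sum>m<p * (k + 1). V m * ?B $$ (m, c))"
    by (intro sum.cong refl) (simp only: lessThan_iff Suc.IH V_def W_def)
  also have "\<dots> = (\<Sum>q<p. V (p * ?\<beta> + q) * T $$ (q, ?\<gamma>)) + (if ?\<beta> = 0 then 0 else V (p * (?\<beta> - 1) + ?\<gamma>))"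
    by (rule sum_block_col[OF T Suc.prems])
  also have "(\<Sum>q<p. V (p * ?\<beta> + q) * T $$ (q, ?\<gamma>)) = real (n choose ?\<beta>) * W (Suc (n - ?\<beta>)) ?\<gamma>"
    using p by (simp add: V_def W_Suc sum_distrib_left mult.assoc)
  also have "V (p * (?\<beta> - 1) + ?\<gamma>) = real (n choose (?\<beta> - 1)) * W (n - (?\<beta> - 1)) ?\<gamma>"
    using p by (simp add: V_def)
  also have "real (n choose ?\<beta>) * W (Suc (n - ?\<beta>)) ?\<gamma>
      + (if ?\<beta> = 0 then 0 else real (n choose (?\<beta> - 1)) * W (n - (?\<beta> - 1)) ?\<gamma>)
      = real (Suc n choose ?\<beta>) * W (Suc n - ?\<beta>) ?\<gamma>"
  \<comment> \<open>Pascal's rule. If \<open>Suc b \<le> n\<close>, all exponents equal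
    \<open>n - b\<close>; otherwise the first coefficient is 0 and the second term alone gives the
    right side.\<close>
  proof (cases "?\<beta>")
    case 0
    then show ?thesis by simp
  next
    case (Suc b)
    show ?thesis
    proof (cases "Suc b \<le> n")
      case True
      then have "Suc (n - Suc b) = n - b" by simp
      then show ?thesis using Suc by (simp add: algebra_simps)
    next
      case False
      then show ?thesis using Suc by (simp add: binomial_eq_0)
    qed
  qed
  finally show ?case by (simp only: W_def)
qed

text \<open>\<open>block_t\<close> selects the last block, so the n-th coefficient is (n choose k)
  \<alpha> T^(n-k) t / n!. Multiplied by k! and shifted by k, this is the series of the original
  function times x^k.\<close>

lemma me_fun_block:
  assumes a: "\<alpha> \<in> carrier_mat 1 p" and T: "T \<in> carrier_mat p p" and t: "t \<in> carrier_mat p 1"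
  shows "fact k * me_fun (block_alpha \<alpha> k, block_T T k 0, block_t t k) x = x ^ k * me_fun (\<alpha>, T, t) x"
proof (cases "p = 0")
  case True
  then show ?thesis
    using me_fun_eq_sum[OF a T t] me_fun_eq_sum[OF block_alpha_carrier[OF a] block_T_carrier[OF T] block_t_carrier[OF t]]
    by simp
next
  case False
  then have p: "p > 0" by simp
  let ?a = "block_alpha \<alpha> k" and ?B = "block_T T k 0" and ?t = "block_t t k"
  define b where "b m = (\<alpha> * T ^\<^sub>m m * t) $$ (0, 0)" for m
  have coef: "(?a * ?B ^\<^sub>m n * ?t) $$ (0, 0) = real (n choose k) * b (n - k)" for n
  proof -
    have t0: "?t $$ (p * c + q, 0) = (if c = k then t $$ (q, 0) else 0)" if "c < k + 1" "q < p" for c q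
    proof (cases "c = k")
      case True
      then show ?thesis using that t by (auto simp: block_t_def Let_def)
    next
      case False
      then have "p * c + p \<le> p * k" using that by (metis Suc_eq_plus1 Suc_leI less_Suc_eq mult_Suc_right add.commute mult_le_mono2)
      then have "p * c + q < p * k" using that by simp
      moreover have "p * k \<le> p * (k + 1)" by simp
      ultimately show ?thesis using False t by (auto simp: block_t_def Let_def)
    qed
    have "(?a * ?B ^\<^sub>m n * ?t) $$ (0, 0) = (\<Sum>c<p * (k + 1). (?a * ?B ^\<^sub>m n) $$ (0, c) * ?t $$ (c, 0))"
      by (rule index_mult_mat_sum[OF mult_carrier_mat[OF block_alpha_carrier[OF a] pow_carrier_mat[OF block_T_carrier[OF T]]] block_t_carrier[OF t]]) auto
    also have "\<dots> = (\<Sum>c<p * (k + 1). real (n choose (c div p)) * (\<alpha> * T ^\<^sub>m (n - c div p)) $$ (0, c mod p) * ?t $$ (c, 0))"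
      by (intro sum.cong refl) (simp only: lessThan_iff block_alpha_pow[OF a T])
    also have "\<dots> = (\<Sum>c<k + 1. \<Sum>q<p. real (n choose c) * (\<alpha> * T ^\<^sub>m (n - c)) $$ (0, q) * (if c = k then t $$ (q, 0) else 0))"
      unfolding sum_lessThan_mult by (intro sum.cong refl) (simp add: t0 del: index_mult_mat(1))
    also have "\<dots> = (\<Sum>q<p. real (n choose k) * (\<alpha> * T ^\<^sub>m (n - k)) $$ (0, q) * t $$ (q, 0))"
      by simp
    also have "\<dots> = real (n choose k) * b (n - k)"
      unfolding b_def using index_mult_mat_sum[OF mult_carrier_mat[OF a pow_carrier_mat[OF T]] t, of 0 0]
      by (simp add: sum_distrib_left mult.assoc del: index_mult_mat(1))
    finally show ?thesis .
  qed
  have s: "(\<lambda>n. real (n choose k) * b (n - k) / fact n * x ^ n) sums me_fun (?a, ?B, ?t) x"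
    using me_fun_sums[OF block_alpha_carrier[OF a, of k] block_T_carrier[OF T, of k 0] block_t_carrier[OF t, of k], of x]
    by (simp only: coef)
  \<comment> \<open>The first \<open>k\<close> terms vanish, as \<open>n choose k\<close> is 0 for
    \<open>n < k\<close>, so the shift loses nothing.\<close>
  have "(\<lambda>n. real (n + k choose k) * b (n + k - k) / fact (n + k) * x ^ (n + k)) sums me_fun (?a, ?B, ?t) x"
    using sums_split_initial_segment[OF s, of k] by (simp add: binomial_eq_0)
  then have "(\<lambda>n. fact k * (real (n + k choose k) * b (n + k - k) / fact (n + k) * x ^ (n + k)))
      sums (fact k * me_fun (?a, ?B, ?t) x)" by (rule sums_mult)
  moreover have "fact k * (real (n + k choose k) * b (n + k - k) / fact (n + k) * x ^ (n + k)) = x ^ k * (b n / fact n * x ^ n)" for n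
    by (simp add: binomial_fact power_add)
  moreover have "(\<lambda>n. x ^ k * (b n / fact n * x ^ n)) sums (x ^ k * me_fun (\<alpha>, T, t) x)"
    unfolding b_def by (intro sums_mult me_fun_sums[OF a T t])
  ultimately show ?thesis by (simp add: sums_unique2)
qed

section \<open>Sums of independent components\<close>

text \<open>Extension by 0 to the whole line, with values in \<open>ennreal\<close> so that Tonelli
  requires only measurability.\<close>

definition me_dens :: "me_triple \<Rightarrow> real \<Rightarrow> ennreal" where
  "me_dens tr s = ennreal (me_fun tr s) * indicator {0..} s"

lemma me_ok_borel_measurable:
  assumes "me_ok tr"
  shows "me_fun tr \<in> borel_measurable borel"
  using assms borel_measurable_me_fun by (cases tr) (auto simp: me_ok_def)

lemma me_dens_measurable: "me_ok tr \<Longrightarrow> me_dens tr \<in> borel_measurable borel"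
  using me_ok_borel_measurable[of tr] unfolding me_dens_def[abs_def] by measurable

text \<open>Tonelli, the substitution s = y + u at fixed u, and Tonelli again turn the inner
  integral into a convolution.\<close>

lemma nn_integral_me_dens_add:
  assumes ok: "me_ok tr" "me_ok tr'" and [measurable]: "\<phi> \<in> borel_measurable borel"
  shows "(\<integral>\<^sup>+y. (\<integral>\<^sup>+u. me_dens tr y * me_dens tr' u * \<phi> (y + u) \<partial>lborel) \<partial>lborel)
       = (\<integral>\<^sup>+s. me_dens (conv2 tr tr') s * \<phi> s \<partial>lborel)"
proof -
  note [measurable] = me_dens_measurable[OF ok(1)] me_dens_measurable[OF ok(2)]
  have "(\<integral>\<^sup>+y. (\<integral>\<^sup>+u. me_dens tr y * me_dens tr' u * \<phi> (y + u) \<partial>lborel) \<partial>lborel)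
      = (\<integral>\<^sup>+u. (\<integral>\<^sup>+y. me_dens tr y * me_dens tr' u * \<phi> (y + u) \<partial>lborel) \<partial>lborel)"
    by (rule lborel_pair.Fubini') measurable
  also have "\<dots> = (\<integral>\<^sup>+u. (\<integral>\<^sup>+s. me_dens tr (s - u) * me_dens tr' u * \<phi> s \<partial>lborel) \<partial>lborel)"
  proof (rule nn_integral_cong)
    fix u :: real
    show "(\<integral>\<^sup>+y. me_dens tr y * me_dens tr' u * \<phi> (y + u) \<partial>lborel)
        = (\<integral>\<^sup>+s. me_dens tr (s - u) * me_dens tr' u * \<phi> s \<partial>lborel)"
      using nn_integral_real_affine[of "\<lambda>y. me_dens tr y * me_dens tr' u * \<phi> (y + u)" 1 "- u"]
      by simp
  qed
  also have "\<dots> = (\<integral>\<^sup>+s. (\<integral>\<^sup>+u. me_dens tr (s - u) * me_dens tr' u * \<phi> s \<partial>lborel) \<partial>lborel)"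
    by (rule lborel_pair.Fubini'[symmetric]) measurable
  also have "\<dots> = (\<integral>\<^sup>+s. me_dens (conv2 tr tr') s * \<phi> s \<partial>lborel)"
  proof (rule nn_integral_cong)
    fix s :: real
    \<comment> \<open>The two cut-offs confine \<open>u\<close> to \<open>{0..s}\<close>; for
      negative \<open>s\<close> one of them always vanishes.\<close>
    have "(\<integral>\<^sup>+u. me_dens tr (s - u) * me_dens tr' u \<partial>lborel) = me_dens (conv2 tr tr') s"
    proof (cases "s \<ge> 0")
      case True
      have nn: "me_fun tr x \<ge> 0" "me_fun tr' x \<ge> 0" if "x \<ge> 0" for x
        using ok that by (auto simp: me_ok_def split: prod.splits)
      have "me_dens tr (s - u) * me_dens tr' u
          = ennreal (me_fun tr (s - u) * me_fun tr' u) * indicator {0..s} u" for u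
        using nn[of "s - u"] nn[of u]
        by (auto simp: me_dens_def ennreal_mult split: split_indicator)
      then show ?thesis
        using nn_integral_conv2[OF ok True] True by (simp add: me_dens_def)
    next
      case False
      then have zero: "me_dens tr (s - u) * me_dens tr' u = 0" for u
        by (auto simp: me_dens_def split: split_indicator)
      have "(\<integral>\<^sup>+u. me_dens tr (s - u) * me_dens tr' u \<partial>lborel) = 0"
        unfolding zero by simp
      then show ?thesis using False by (simp add: me_dens_def)
    qed
    then show "(\<integral>\<^sup>+u. me_dens tr (s - u) * me_dens tr' u * \<phi> s \<partial>lborel) = me_dens (conv2 tr tr') s * \<phi> s"
      by (simp add: nn_integral_multc)
  qed
  finally show ?thesis .
qed

lemma conv_triple_Cons:
  "ks \<noteq> [] \<Longrightarrow> conv_triple F (k # ks) = conv2 (F k) (conv_triple F ks)"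
  by (cases ks; cases "F k"; cases "conv_triple F ks") (auto split: prod.splits)

text \<open>Allows a sequence of indices to be replaced by the positions carrying them, which also
  number the coordinates.\<close>

lemma conv_triple_map: "conv_triple F (map f ks) = conv_triple (\<lambda>k. F (f k)) ks"
proof (induction ks)
  case (Cons k ks)
  then show ?case by (cases "ks = []") (simp_all add: conv_triple_Cons del: conv2.simps)
qed simp

lemma conv_triple_cong: "(\<And>k. k \<in> set ks \<Longrightarrow> F k = G k) \<Longrightarrow> conv_triple F ks = conv_triple G ks"
proof (induction ks)
  case (Cons k ks)
  then show ?case by (cases "ks = []") (simp_all add: conv_triple_Cons del: conv2.simps)
qed simp

lemma me_ok_conv_triple:
  "ks \<noteq> [] \<Longrightarrow> (\<And>k. k \<in> set ks \<Longrightarrow> me_ok (F k)) \<Longrightarrow> me_ok (conv_triple F ks)"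
  by (induction ks rule: list_nonempty_induct) (simp_all add: conv_triple_Cons me_ok_conv2 del: conv2.simps)

text \<open>One coordinate is integrated last and its value is absorbed into the test function,
  hence the arbitrary \<open>\<phi>\<close>. The left side does not see the order of
  \<open>ms\<close>, so any order of convolution may be chosen; this later permits moving
  \<open>j\<close> to the front.\<close>

lemma nn_integral_PiM_me_dens:
  assumes "ms \<noteq> []" "distinct ms" "\<And>m. m \<in> set ms \<Longrightarrow> me_ok (G m)" "\<phi> \<in> borel_measurable borel"
  shows "(\<integral>\<^sup>+x. (\<Prod>m\<in>set ms. me_dens (G m) (x m)) * \<phi> (\<Sum>m\<in>set ms. x m) \<partial>PiM (set ms) (\<lambda>_. lborel))
      = (\<integral>\<^sup>+s. me_dens (conv_triple G ms) s * \<phi> s \<partial>lborel)"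
  using assms
proof (induction ms arbitrary: \<phi> rule: list_nonempty_induct)
  case (single m)
  interpret product_sigma_finite "\<lambda>_. lborel" ..
  have [measurable]: "me_dens (G m) \<in> borel_measurable borel" using single by (simp add: me_dens_measurable)
  show ?case
    using single product_nn_integral_singleton[of "\<lambda>s. me_dens (G m) s * \<phi> s" m] by simp
next
  case (cons m ms)
  interpret product_sigma_finite "\<lambda>_. lborel" ..
  have m: "m \<notin> set ms" using cons.prems by simp
  have [measurable]: "me_dens (G k) \<in> borel_measurable borel" if "k \<in> insert m (set ms)" for k
    using that cons.prems by (simp add: me_dens_measurable)
  note [measurable] = \<open>\<phi> \<in> borel_measurable borel\<close>
  have okC: "me_ok (conv_triple G ms)" using cons by (intro me_ok_conv_triple) auto
  note [measurable] = me_dens_measurable[OF okC]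
  have "(\<integral>\<^sup>+x. (\<Prod>k\<in>insert m (set ms). me_dens (G k) (x k)) * \<phi> (\<Sum>k\<in>insert m (set ms). x k) \<partial>PiM (insert m (set ms)) (\<lambda>_. lborel))
     = (\<integral>\<^sup>+y. (\<integral>\<^sup>+x. (\<Prod>k\<in>insert m (set ms). me_dens (G k) ((x(m := y)) k)) * \<phi> (\<Sum>k\<in>insert m (set ms). (x(m := y)) k) \<partial>PiM (set ms) (\<lambda>_. lborel)) \<partial>lborel)"
    using m by (intro product_nn_integral_insert_rev) auto
  also have "\<dots> = (\<integral>\<^sup>+y. (\<integral>\<^sup>+x. me_dens (G m) y * ((\<Prod>k\<in>set ms. me_dens (G k) (x k)) * \<phi> (y + (\<Sum>k\<in>set ms. x k))) \<partial>PiM (set ms) (\<lambda>_. lborel)) \<partial>lborel)"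
  proof (intro nn_integral_cong)
    fix x y
    have "(\<Prod>k\<in>set ms. me_dens (G k) ((x(m := y)) k)) = (\<Prod>k\<in>set ms. me_dens (G k) (x k))"
      "(\<Sum>k\<in>set ms. (x(m := y)) k) = (\<Sum>k\<in>set ms. x k)"
      using m by (auto intro!: prod.cong sum.cong)
    then show "(\<Prod>k\<in>insert m (set ms). me_dens (G k) ((x(m := y)) k)) * \<phi> (\<Sum>k\<in>insert m (set ms). (x(m := y)) k)
        = me_dens (G m) y * ((\<Prod>k\<in>set ms. me_dens (G k) (x k)) * \<phi> (y + (\<Sum>k\<in>set ms. x k)))"
      using m by (simp add: mult.assoc)
  qed
  also have "\<dots> = (\<integral>\<^sup>+y. me_dens (G m) y * (\<integral>\<^sup>+x. (\<Prod>k\<in>set ms. me_dens (G k) (x k)) * \<phi> (y + (\<Sum>k\<in>set ms. x k)) \<partial>PiM (set ms) (\<lambda>_. lborel)) \<partial>lborel)"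
    by (intro nn_integral_cong nn_integral_cmult) auto
  \<comment> \<open>The induction hypothesis is applied, for each fixed \<open>y\<close>, to the
    test function u \<mapsto> \<phi>(y + u).\<close>
  also have "\<dots> = (\<integral>\<^sup>+y. me_dens (G m) y * (\<integral>\<^sup>+u. me_dens (conv_triple G ms) u * \<phi> (y + u) \<partial>lborel) \<partial>lborel)"
    using cons.prems by (subst cons.IH) auto
  also have "\<dots> = (\<integral>\<^sup>+y. (\<integral>\<^sup>+u. me_dens (G m) y * me_dens (conv_triple G ms) u * \<phi> (y + u) \<partial>lborel) \<partial>lborel)"
    by (intro nn_integral_cong, subst nn_integral_cmult[symmetric]) (auto simp: mult.assoc)
  also have "\<dots> = (\<integral>\<^sup>+s. me_dens (conv2 (G m) (conv_triple G ms)) s * \<phi> s \<partial>lborel)"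
    using cons.prems okC by (intro nn_integral_me_dens_add) auto
  finally show ?case using cons.hyps by (simp add: conv_triple_Cons)
qed

section \<open>Tail moments of a product density\<close>

definition tail_value :: "me_triple \<Rightarrow> nat \<Rightarrow> real \<Rightarrow> real" where
  "tail_value tr h y = (case tr of (\<alpha>, T, t) \<Rightarrow> (\<alpha> * (mat_exp (y \<cdot>\<^sub>m T) * neg_inv_sum T h y) * t) $$ (0, 0))"

lemma nn_integral_me_dens_tail:
  assumes ok: "me_ok tr" and y: "y \<ge> 0"
  shows "(\<integral>\<^sup>+s. me_dens tr s * ennreal (s ^ h * indicator {y<..} s) \<partial>lborel) = ennreal (tail_value tr h y)"
    and "tail_value tr h y \<ge> 0"
proof -
  obtain \<alpha> T t where tr: "tr = (\<alpha>, T, t)" by (cases tr)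
  obtain n where c: "\<alpha> \<in> carrier_mat 1 n" "T \<in> carrier_mat n n" "t \<in> carrier_mat n 1" "hurwitz T"
    and nn: "\<And>x. x \<ge> 0 \<Longrightarrow> me_fun (\<alpha>, T, t) x \<ge> 0"
    using ok unfolding tr me_ok_def by auto
  note tail = me_fun_tail_moment[OF c nn y, of h]
  show "tail_value tr h y \<ge> 0" using tail(2) by (simp add: tr tail_value_def)
  \<comment> \<open>The open and the closed half line differ only in the null set
    \<open>{y}\<close>, and \<open>s > y \<ge> 0\<close> lies inside the cut-off of
    \<open>me_dens\<close>.\<close>
  have "AE s in lborel. me_dens tr s * ennreal (s ^ h * indicator {y<..} s)
      = ennreal (s ^ h * me_fun (\<alpha>, T, t) s) * indicator {y..} s"
    using AE_lborel_singleton[of y]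
  proof eventually_elim
    case (elim s)
    show ?case
    proof (cases "s > y")
      case True
      then show ?thesis using nn[of s] y by (simp add: tr me_dens_def ennreal_mult mult.commute)
    next
      case False
      then show ?thesis using elim by simp
    qed
  qed
  then show "(\<integral>\<^sup>+s. me_dens tr s * ennreal (s ^ h * indicator {y<..} s) \<partial>lborel) = ennreal (tail_value tr h y)"
    using tail(1) by (simp add: nn_integral_cong_AE tr tail_value_def)
qed

text \<open>Integrability and value come together from the nonnegative integral, so that mixture
  terms can afterwards be combined with weights of either sign.\<close>

lemma has_bochner_integral_me_prod:
  assumes ms: "ms \<noteq> []" "distinct ms" "set ms = I" and ok: "\<And>m. m \<in> I \<Longrightarrow> me_ok (G m)" and y: "y \<ge> 0"
  shows "has_bochner_integral (PiM I (\<lambda>_. lborel))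
    (\<lambda>x. (if \<forall>m\<in>I. 0 \<le> x m then \<Prod>m\<in>I. me_fun (G m) (x m) else 0)
       * ((\<Sum>m\<in>I. x m) ^ h * indicator {y<..} (\<Sum>m\<in>I. x m)))
    (tail_value (conv_triple G ms) h y)"
proof -
  let ?q = "\<lambda>x. (if \<forall>m\<in>I. 0 \<le> x m then \<Prod>m\<in>I. me_fun (G m) (x m) else (0::real))"
  let ?\<phi> = "\<lambda>s::real. s ^ h * indicator {y<..} s"
  have fin: "finite I" using ms by auto
  have okC: "me_ok (conv_triple G ms)" using ms ok by (intro me_ok_conv_triple) auto
  have [measurable]: "me_fun (G m) \<in> borel_measurable borel" if "m \<in> I" for m
    using ok[OF that] by (rule me_ok_borel_measurable)
  have nn: "me_fun (G m) u \<ge> 0" if "m \<in> I" "u \<ge> 0" for m u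
    using ok[OF that(1)] that(2) by (auto simp: me_ok_def split: prod.splits)
  \<comment> \<open>Outside the orthant some factor \<open>me_dens\<close> is 0, matching the
    default value 0.\<close>
  have q: "ennreal (?q x) = (\<Prod>m\<in>I. me_dens (G m) (x m))" for x
  proof (cases "\<forall>m\<in>I. 0 \<le> x m")
    case True
    then have "(\<Prod>m\<in>I. me_dens (G m) (x m)) = (\<Prod>m\<in>I. ennreal (me_fun (G m) (x m)))"
      by (intro prod.cong) (auto simp: me_dens_def)
    also have "\<dots> = ennreal (\<Prod>m\<in>I. me_fun (G m) (x m))"
      using True nn by (intro prod_ennreal) auto
    finally show ?thesis using True by simp
  next
    case False
    then obtain m where m: "m \<in> I" "\<not> 0 \<le> x m" by blast
    then have "me_dens (G m) (x m) = 0" by (simp add: me_dens_def)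
    then have "(\<Prod>m\<in>I. me_dens (G m) (x m)) = 0" using fin m by (intro prod_zero) auto
    then show ?thesis using False by auto
  qed
  have q0: "?q x \<ge> 0" for x using nn by (auto intro!: prod_nonneg)
  have \<phi>0: "?\<phi> s \<ge> 0" for s using y by (auto split: split_indicator)
  show ?thesis
  proof (rule has_bochner_integral_nn_integral)
    show "(\<lambda>x. ?q x * ?\<phi> (\<Sum>m\<in>I. x m)) \<in> borel_measurable (PiM I (\<lambda>_. lborel))"
      using fin by measurable
    show "AE x in PiM I (\<lambda>_. lborel). 0 \<le> ?q x * ?\<phi> (\<Sum>m\<in>I. x m)"
      by (intro AE_I2) (rule mult_nonneg_nonneg[OF q0 \<phi>0])
    show "0 \<le> tail_value (conv_triple G ms) h y" by (rule nn_integral_me_dens_tail[OF okC y])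
    have "(\<integral>\<^sup>+x. ennreal (?q x * ?\<phi> (\<Sum>m\<in>I. x m)) \<partial>PiM I (\<lambda>_. lborel))
        = (\<integral>\<^sup>+x. (\<Prod>m\<in>I. me_dens (G m) (x m)) * ennreal (?\<phi> (\<Sum>m\<in>I. x m)) \<partial>PiM I (\<lambda>_. lborel))"
      by (intro nn_integral_cong) (simp only: q[symmetric] ennreal_mult[OF q0 \<phi>0])
    also have "\<dots> = (\<integral>\<^sup>+s. me_dens (conv_triple G ms) s * ennreal (?\<phi> s) \<partial>lborel)"
      using nn_integral_PiM_me_dens[OF ms(1,2), of G "\<lambda>s. ennreal (?\<phi> s)"] ok ms(3) by simp
    also have "\<dots> = ennreal (tail_value (conv_triple G ms) h y)"
      by (rule nn_integral_me_dens_tail[OF okC y])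
    finally show "(\<integral>\<^sup>+x. ennreal (?q x * ?\<phi> (\<Sum>m\<in>I. x m)) \<partial>PiM I (\<lambda>_. lborel))
        = ennreal (tail_value (conv_triple G ms) h y)" .
  qed
qed

section \<open>Powers of one coordinate, and positions in an index list\<close>

lemma me_ok_ME_triple: "ME_triple tr \<Longrightarrow> me_ok tr"
  unfolding ME_triple_def me_ok_def hurwitz_def by (cases tr) (simp only: prod.case, blast)

fun block_triple :: "nat \<Rightarrow> me_triple \<Rightarrow> me_triple" where
  "block_triple k (\<alpha>, T, t) = (block_alpha \<alpha> k, block_T T k 0, block_t t k)"

lemma me_fun_block_triple:
  "me_ok tr \<Longrightarrow> fact k * me_fun (block_triple k tr) x = x ^ k * me_fun tr x"
  unfolding me_ok_def by (cases tr) (simp only: prod.case block_triple.simps, blast intro: me_fun_block)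

text \<open>Nonnegativity is obtained from the power identity after division by
  \<open>fact k\<close>.\<close>

lemma me_ok_block_triple:
  assumes "me_ok tr"
  shows "me_ok (block_triple k tr)"
proof -
  have "me_fun (block_triple k tr) x \<ge> 0" if "x \<ge> 0" for x
  proof -
    have "0 \<le> x ^ k * me_fun tr x" using assms that by (auto simp: me_ok_def split: prod.splits)
    moreover have "me_fun (block_triple k tr) x = x ^ k * me_fun tr x / fact k"
      using me_fun_block_triple[OF assms, of k x] by (simp add: eq_divide_eq mult.commute)
    ultimately show ?thesis by simp
  qed
  moreover obtain \<alpha> T t where tr: "tr = (\<alpha>, T, t)" by (cases tr)
  moreover obtain n where "\<alpha> \<in> carrier_mat 1 n" "T \<in> carrier_mat n n" "t \<in> carrier_mat n 1" "hurwitz T"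
    using assms unfolding tr me_ok_def prod.case by blast
  ultimately show ?thesis
    unfolding me_ok_def tr block_triple.simps prod.case
    using block_alpha_carrier[of \<alpha> n k] block_T_carrier[of T n k 0] block_t_carrier[of t n k] hurwitz_block_T[of T n k]
    by blast
qed

lemma map_nth_pred: "length xs = M \<Longrightarrow> map (\<lambda>m. xs ! (m - 1)) [1..<M + 1] = xs"
  by (intro nth_equalityI) (auto simp del: upt_Suc)

lemma drop_idx_eq_map:
  assumes "length is = M" "j \<in> {1..M}"
  shows "drop_idx is j = map (\<lambda>m. is ! (m - 1)) ([1..<j] @ [j + 1..<M + 1])"
  using assms by (intro nth_equalityI) (auto simp: drop_idx_def nth_append min_def simp del: upt_Suc)

text \<open>\<open>A_mat\<close> is the matrix of the convolution of the block triple with the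
  triple of the remaining indices. The zero paddings agree because \<open>dim_row t'\<close> equals
  \<open>dim_col \<alpha>'\<close>.\<close>

lemma A_mat_term_eq_tail_value:
  assumes ok1: "me_ok (F (is ! (j - 1)))" and ok2: "me_ok (conv_triple F (drop_idx is j))"
  shows "(let A = A_mat F k is j;
                \<alpha>k = block_alpha (fst (F (is ! (j - 1)))) k;
                t' = snd (snd (conv_triple F (drop_idx is j)))
            in (append_cols_mat \<alpha>k (0\<^sub>m 1 (dim_row t')) *
                (mat_exp (y \<cdot>\<^sub>m A) * neg_inv_sum A h y)
                * (0\<^sub>m (dim_row A - dim_row t') 1 @\<^sub>r t')) $$ (0, 0))
     = tail_value (conv2 (block_triple k (F (is ! (j - 1)))) (conv_triple F (drop_idx is j))) h y"
proof -
  obtain \<alpha> T t where tr: "F (is ! (j - 1)) = (\<alpha>, T, t)" by (cases "F (is ! (j - 1))")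
  obtain \<alpha>' T' t' where tr': "conv_triple F (drop_idx is j) = (\<alpha>', T', t')"
    by (cases "conv_triple F (drop_idx is j)")
  obtain n where n: "\<alpha> \<in> carrier_mat 1 n" "T \<in> carrier_mat n n" "t \<in> carrier_mat n 1"
    using ok1 by (auto simp: tr me_ok_def simp del: One_nat_def)
  obtain m where m: "\<alpha>' \<in> carrier_mat 1 m" "T' \<in> carrier_mat m m" "t' \<in> carrier_mat m 1"
    using ok2 by (auto simp: tr' me_ok_def simp del: One_nat_def)
  have B: "dim_row (block_T T k 0) = n * (k + 1)" "dim_col (block_T T k 0) = n * (k + 1)"
    using block_T_carrier[OF n(2), of k 0] by auto
  have A: "A_mat F k is j = four_block_mat (block_T T k 0) (block_t t k * \<alpha>') (0\<^sub>m m (n * (k + 1))) T'"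
    using n m by (simp add: A_mat_def tr tr' del: One_nat_def)
  then have "dim_row (A_mat F k is j) - dim_row t' = n * (k + 1)"
    using B m by simp
  then show ?thesis
    using B n m by (simp add: tail_value_def tr tr' A Let_def del: One_nat_def)
qed

section \<open>The two expectation formulas\<close>

theorem theorem12:
  fixes P :: "'a measure" and X :: "'a \<Rightarrow> nat \<Rightarrow> real"
    and F :: "nat \<Rightarrow> me_triple" and L M :: nat and p :: "nat list \<Rightarrow> real"
    and j :: nat
  assumes "prob_space P"
    and "L \<ge> 1" and "M \<ge> 2"
    and "\<forall>l\<in>{1..L}. ME_triple (F l)"
    and "(\<Sum>is\<in>idx_set L M. p is) = 1"
    and "\<forall>x. mmeam_dens F L M p x \<ge> 0"
    and "distributed P (PiM {1..M} (\<lambda>_. lborel)) X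
           (\<lambda>x. ennreal (mmeam_dens F L M p x))"
    and "j \<in> {1..M}"
  shows
    "(\<forall>(h::nat) (y::real). y \<ge> 0 \<longrightarrow>
       (\<integral>\<omega>. (\<Sum>m\<in>{1..M}. X \<omega> m) ^ h * indicator {y<..} (\<Sum>m\<in>{1..M}. X \<omega> m) \<partial>P)
       = (\<Sum>is\<in>idx_set L M. p is *
           (case conv_triple F is of (\<alpha>, T, t) \<Rightarrow>
             (\<alpha> * (mat_exp (y \<cdot>\<^sub>m T) * neg_inv_sum T h y) * t) $$ (0, 0))))
     \<and>
     (\<forall>(k::nat) (h::nat) (y::real). k \<ge> 1 \<longrightarrow> y \<ge> 0 \<longrightarrow>
       (\<integral>\<omega>. X \<omega> j ^ k * (\<Sum>m\<in>{1..M}. X \<omega> m) ^ h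
              * indicator {y<..} (\<Sum>m\<in>{1..M}. X \<omega> m) \<partial>P)
       = (\<Sum>is\<in>idx_set L M. p is * fact k *
           (let A = A_mat F k is j;
                \<alpha>k = block_alpha (fst (F (is ! (j - 1)))) k;
                t' = snd (snd (conv_triple F (drop_idx is j)))
            in (append_cols_mat \<alpha>k (0\<^sub>m 1 (dim_row t')) *
                (mat_exp (y \<cdot>\<^sub>m A) * neg_inv_sum A h y)
                * (0\<^sub>m (dim_row A - dim_row t') 1 @\<^sub>r t')) $$ (0, 0))))"
proof -
  let ?N = "PiM {1..M} (\<lambda>_. lborel :: real measure)"
  \<comment> \<open>The triple attached to coordinate \<open>m\<close>; coordinates start at 1, list
    positions at 0.\<close>
  define g where "g is m = F (is ! (m - 1))" for "is" and m :: nat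
  define Q where "Q G x = (if \<forall>m\<in>{1..M}. 0 \<le> x m then \<Prod>m\<in>{1..M}. me_fun (G m) (x m) else 0)"
    for G and x :: "nat \<Rightarrow> real"
  define S where "S h y x = (\<Sum>m\<in>{1..M}. x m) ^ h * indicator {y<..} (\<Sum>m\<in>{1..M}. x m)"
    for h :: nat and y :: real and x :: "nat \<Rightarrow> real"
  have ok: "me_ok (g is m)" if "is \<in> idx_set L M" "m \<in> {1..M}" for "is" m
  proof -
    have "is ! (m - 1) \<in> set is" using that by (auto simp: idx_set_def)
    then show ?thesis using that assms(4) by (auto simp: g_def idx_set_def intro!: me_ok_ME_triple)
  qed
  have dens: "mmeam_dens F L M p x = (\<Sum>is\<in>idx_set L M. p is * Q (g is) x)" for x
  proof (cases "\<forall>m\<in>{1..M}. 0 \<le> x m")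
    case True
    then show ?thesis by (simp add: mmeam_dens_def Q_def g_def)
  next
    case False
    then show ?thesis by (simp only: mmeam_dens_def Q_def if_False mult_zero_right sum.neutral_const)
  qed
  \<comment> \<open>Every mixture term is integrable against \<open>f\<close> on its own, so
    linearity holds despite negative weights; the density then transfers the integral to
    \<open>P\<close>.\<close>
  have expect: "(\<integral>\<omega>. f (X \<omega>) \<partial>P) = (\<Sum>is\<in>idx_set L M. p is * v is)"
    if f: "f \<in> borel_measurable ?N"
      and v: "\<And>is. is \<in> idx_set L M \<Longrightarrow> has_bochner_integral ?N (\<lambda>x. Q (g is) x * f x) (v is)" for f v
  proof -
    have "has_bochner_integral ?N (\<lambda>x. \<Sum>is\<in>idx_set L M. p is * (Q (g is) x * f x)) (\<Sum>is\<in>idx_set L M. p is * v is)"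
      using v by (intro has_bochner_integral_sum has_bochner_integral_mult_right) auto
    moreover have "(\<Sum>is\<in>idx_set L M. p is * (Q (g is) x * f x)) = mmeam_dens F L M p x * f x" for x
      by (simp add: dens sum_distrib_right mult.assoc)
    ultimately have "(\<integral>x. mmeam_dens F L M p x * f x \<partial>?N) = (\<Sum>is\<in>idx_set L M. p is * v is)"
      by (simp add: has_bochner_integral_integral_eq)
    then show ?thesis
      using distributed_integral[OF assms(7) f] assms(6) by simp
  qed
  have S_meas [measurable]: "S h y \<in> borel_measurable ?N" for h y
    unfolding S_def[abs_def] by measurable
  show ?thesis
  proof (intro conjI allI impI)
    fix h :: nat and y :: real assume y: "y \<ge> 0"
    have "has_bochner_integral ?N (\<lambda>x. Q (g is) x * S h y x) (tail_value (conv_triple F is) h y)"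
      if "is": "is \<in> idx_set L M" for "is"
    proof -
      have "has_bochner_integral ?N (\<lambda>x. Q (g is) x * S h y x) (tail_value (conv_triple (g is) [1..<M + 1]) h y)"
        unfolding Q_def S_def using assms(3) ok[OF "is"] y
        by (intro has_bochner_integral_me_prod) auto
      moreover have "conv_triple (g is) [1..<M + 1] = conv_triple F is"
        using map_nth_pred[of "is" M] "is" conv_triple_map[of F "\<lambda>m. is ! (m - 1)" "[1..<M + 1]"]
        by (simp add: g_def[abs_def] idx_set_def del: upt_Suc)
      ultimately show ?thesis by simp
    qed
    from expect[OF S_meas this]
    show "(\<integral>\<omega>. (\<Sum>m\<in>{1..M}. X \<omega> m) ^ h * indicator {y<..} (\<Sum>m\<in>{1..M}. X \<omega> m) \<partial>P)
       = (\<Sum>is\<in>idx_set L M. p is *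
           (case conv_triple F is of (\<alpha>, T, t) \<Rightarrow>
             (\<alpha> * (mat_exp (y \<cdot>\<^sub>m T) * neg_inv_sum T h y) * t) $$ (0, 0)))"
      by (simp only: S_def tail_value_def)
  next
    fix k h :: nat and y :: real assume y: "y \<ge> 0"
    have meas: "(\<lambda>x. x j ^ k * S h y x) \<in> borel_measurable ?N"
      using assms(8) by measurable
    have "has_bochner_integral ?N (\<lambda>x. Q (g is) x * (x j ^ k * S h y x))
        (fact k * tail_value (conv2 (block_triple k (g is j)) (conv_triple F (drop_idx is j))) h y)"
      if "is": "is \<in> idx_set L M" for "is"
    proof -
      \<comment> \<open>The factor x_j^k is absorbed by exchanging the triple at \<open>j\<close>
        for its block triple; listing \<open>j\<close> first makes the convolution triple have the
        matrix \<open>A_mat\<close>.\<close>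
      define G where "G = (g is)(j := block_triple k (g is j))"
      let ?ms = "[1..<j] @ [j + 1..<M + 1]"
      have ms: "set (j # ?ms) = {1..M}" "distinct (j # ?ms)" "?ms \<noteq> []" using assms(3,8) by auto
      have okG: "me_ok (G m)" if "m \<in> {1..M}" for m
        using ok[OF "is"] that assms(8) by (auto simp: G_def me_ok_block_triple)
      have "conv_triple G ?ms = conv_triple (g is) ?ms"
        by (rule conv_triple_cong) (auto simp: G_def)
      also have "\<dots> = conv_triple F (drop_idx is j)"
        using drop_idx_eq_map[of "is" M j] "is" assms(8) conv_triple_map[of F "\<lambda>m. is ! (m - 1)" ?ms]
        by (simp add: g_def[abs_def] idx_set_def del: upt_Suc map_append)
      finally have "conv_triple G (j # ?ms) = conv2 (block_triple k (g is j)) (conv_triple F (drop_idx is j))"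
        unfolding conv_triple_Cons[OF ms(3), of G j] by (simp only: G_def fun_upd_same)
      moreover have "has_bochner_integral ?N (\<lambda>x. Q G x * S h y x) (tail_value (conv_triple G (j # ?ms)) h y)"
        unfolding Q_def S_def using ms(1,2) okG y by (intro has_bochner_integral_me_prod) auto
      ultimately have "has_bochner_integral ?N (\<lambda>x. fact k * (Q G x * S h y x))
          (fact k * tail_value (conv2 (block_triple k (g is j)) (conv_triple F (drop_idx is j))) h y)"
        by (intro has_bochner_integral_mult_right) simp
      \<comment> \<open>Only the factor at \<open>j\<close> differs between the two products, and
        there \<open>me_fun_block_triple\<close> trades \<open>fact k\<close> for the power.\<close>
      moreover have "fact k * (Q G x * S h y x) = Q (g is) x * (x j ^ k * S h y x)" for x
      proof -
        have remove: "prod f {1..M} = f j * prod f ({1..M} - {j})" for f :: "nat \<Rightarrow> real"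
          using assms(8) by (intro prod.remove) auto
        have Gj: "fact k * me_fun (G j) (x j) = x j ^ k * me_fun (g is j) (x j)"
          using me_fun_block_triple[OF ok[OF "is" assms(8)], of k "x j"] by (simp add: G_def)
        have "(\<Prod>m\<in>{1..M} - {j}. me_fun (G m) (x m)) = (\<Prod>m\<in>{1..M} - {j}. me_fun (g is m) (x m))"
          by (intro prod.cong) (auto simp: G_def)
        then have "fact k * (\<Prod>m\<in>{1..M}. me_fun (G m) (x m)) = x j ^ k * (\<Prod>m\<in>{1..M}. me_fun (g is m) (x m))"
          unfolding remove by (simp only: mult.assoc[symmetric] Gj)
        then have "fact k * Q G x = x j ^ k * Q (g is) x" by (simp add: Q_def)
        then show ?thesis by (metis mult.assoc mult.commute)
      qed
      ultimately show ?thesis by simp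
    qed
    from expect[OF meas this]
    have "(\<integral>\<omega>. X \<omega> j ^ k * S h y (X \<omega>) \<partial>P) = (\<Sum>is\<in>idx_set L M. p is *
        (fact k * tail_value (conv2 (block_triple k (g is j)) (conv_triple F (drop_idx is j))) h y))" .
    also have "\<dots> = (\<Sum>is\<in>idx_set L M. p is * fact k *
           (let A = A_mat F k is j;
                \<alpha>k = block_alpha (fst (F (is ! (j - 1)))) k;
                t' = snd (snd (conv_triple F (drop_idx is j)))
            in (append_cols_mat \<alpha>k (0\<^sub>m 1 (dim_row t')) *
                (mat_exp (y \<cdot>\<^sub>m A) * neg_inv_sum A h y)
                * (0\<^sub>m (dim_row A - dim_row t') 1 @\<^sub>r t')) $$ (0, 0)))"
    proof (rule sum.cong[OF refl])
      fix "is" assume "is": "is \<in> idx_set L M"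
      \<comment> \<open>Since \<open>M \<ge> 2\<close>, at least one index remains, so the remaining
        convolution is over a nonempty list.\<close>
      have "length (drop_idx is j) = M - 1" "set (drop_idx is j) \<subseteq> {1..L}"
        using "is" assms(8) set_take_subset[of "j - 1" "is"] set_drop_subset[of j "is"]
        by (auto simp: idx_set_def drop_idx_def)
      then have "me_ok (conv_triple F (drop_idx is j))"
        using assms(3,4) by (intro me_ok_conv_triple) (auto intro!: me_ok_ME_triple)
      then show "p is * (fact k * tail_value (conv2 (block_triple k (g is j)) (conv_triple F (drop_idx is j))) h y)
        = p is * fact k *
           (let A = A_mat F k is j;
                \<alpha>k = block_alpha (fst (F (is ! (j - 1)))) k;
                t' = snd (snd (conv_triple F (drop_idx is j)))
            in (append_cols_mat \<alpha>k (0\<^sub>m 1 (dim_row t')) *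
                (mat_exp (y \<cdot>\<^sub>m A) * neg_inv_sum A h y)
                * (0\<^sub>m (dim_row A - dim_row t') 1 @\<^sub>r t')) $$ (0, 0))"
        using A_mat_term_eq_tail_value[of F "is" j k y h] ok[OF "is" assms(8)]
        by (simp only: g_def mult.assoc)
    qed
    finally show "(\<integral>\<omega>. X \<omega> j ^ k * (\<Sum>m\<in>{1..M}. X \<omega> m) ^ h
              * indicator {y<..} (\<Sum>m\<in>{1..M}. X \<omega> m) \<partial>P)
       = (\<Sum>is\<in>idx_set L M. p is * fact k *
           (let A = A_mat F k is j;
                \<alpha>k = block_alpha (fst (F (is ! (j - 1)))) k;
                t' = snd (snd (conv_triple F (drop_idx is j)))
            in (append_cols_mat \<alpha>k (0\<^sub>m 1 (dim_row t')) *
                (mat_exp (y \<cdot>\<^sub>m A) * neg_inv_sum A h y)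
                * (0\<^sub>m (dim_row A - dim_row t') 1 @\<^sub>r t')) $$ (0, 0)))"
      by (simp only: S_def mult.assoc)
  qed
qed

end
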